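(* Let $k$ be an $F$-finite field of characteristic $p>0$ with $p\ne 2,3$. Let $Q$ be the quiver with three vertices $1,2,3$, all mutable, with exactly two arrows $1\to2$, two arrows $2\to3$, two arrows $3\to1$, and no other arrows, and let $\mathbf x=\{x_1,x_2,x_3\}$ be a cluster in $\mathcal F=k(x_1,x_2,x_3)$ with $x_i$ at vertex $i$. Then the upper cluster algebra $\mathcal U=\mathcal U(Q,\mathbf x)$ (the Markov upper cluster algebra) is strongly $F$-regular.
   Context: Cluster algebras. Let $k$ be a field and $\mathcal F$ a purely transcendental extension of $k$ of finite transcendence degree $n$. A seed $(Q,\mathbf x)$ for $\mathcal F$ over $k$ consists of: a finite quiver $Q$ with vertices $1,\dots,n$, without loops or directed 2-cycles (multiple arrows allowed); a cluster $\mathbf x=\{x_1,\dots,x_n\}$ of algebraically independent elements with $\mathcal F=k(x_1,\dots,x_n)$, where $x_i$ is the cluster variable at vertex $i$; and a subset of vertices designated frozen, the other vertices being mutable, with the convention that every vertex touching no arrow is frozen. Mutation of the seed at a mutable vertex $\ell$ gives a new seed: the quiver is changed by (1) adding an arrow $i\to j$ for each pair of arrows $i\to \ell\to j$, (2) reversing all arrows incident to $\ell$, (3) cancelling directed 2-cycles in pairs; all cluster variables stay the same except $x_\ell$, which is replaced by $x_\ell'=\big(\prod_{i\to \ell}x_i+\prod_{\ell\to i}x_i\big)x_\ell^{-1}$ (products over all arrows into, resp. out of, $\ell$); frozen vertices stay frozen. Seeds are mutation-equivalent if related by a sequence of mutations. The upper cluster algebra $\mathcal U(Q,\mathbf x)$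 is the intersection in $\mathcal F$ of the Laurent rings $k[y_1^{\pm1},\dots,y_n^{\pm1}]$ over all clusters $\mathbf y=\{y_1,\dots,y_n\}$ of seeds mutation-equivalent to $(Q,\mathbf x)$. Frobenius notions. For a domain $R$ of characteristic $p>0$, $R^{1/p^e}\supseteq R$ is the ring of $p^e$-th roots of elements of $R$ in an algebraic closure of the fraction field of $R$. $R$ is $F$-finite if $R^{1/p}$ is a finitely generated $R$-module. An $F$-finite domain $R$ is strongly $F$-regular if for every nonzero $x\in R$ there exist $e\in\mathbb N$ and $\psi\in \operatorname{Hom}_R(R^{1/p^e},R)$ with $\psi(x^{1/p^e})=1$. *)

theory Defs
  imports
    "HOL-Algebra.Algebraic_Closure_Type"
    "HOL-Algebra.Generated_Rings"
    "HOL-Algebra.Generated_Fields"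
    "HOL-Library.Poly_Mapping"
begin

section \<open>Seeds, mutation and upper cluster algebras\<close>

text \<open>
  The type \<open>'f\<close> is the ambient field, and \<open>K\<close> is a subfield of it.
  The vertices of a seed are \<open>1, ..., nverts S\<close>, the number of arrows from \<open>i\<close> to \<open>j\<close> is
  \<open>arrows S i j\<close>, and values of \<open>cluster S\<close> outside the vertex set are junk.
\<close>

record 'f seed =
  nverts :: nat
  arrows :: "nat \<Rightarrow> nat \<Rightarrow> nat"
  frozen :: "nat set"
  cluster :: "nat \<Rightarrow> 'f"

definition vertices :: "'f seed \<Rightarrow> nat set" where
  "vertices S = {1..nverts S}"

definition mutable :: "'f seed \<Rightarrow> nat set" where
  "mutable S = vertices S - frozen S"

text \<open>
  Polynomials in variables indexed by \<^typ>\<open>nat\<close> are finitely supported maps from exponent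
  vectors to coefficients.
\<close>

definition alg_independent :: "'f::field set \<Rightarrow> nat set \<Rightarrow> (nat \<Rightarrow> 'f) \<Rightarrow> bool" where
  "alg_independent K I y \<longleftrightarrow>
     (\<forall>P :: (nat \<Rightarrow>\<^sub>0 nat) \<Rightarrow>\<^sub>0 'f.
        (\<forall>m. poly_mapping.lookup P m \<in> K) \<longrightarrow> (\<forall>m\<in>Poly_Mapping.keys P. Poly_Mapping.keys m \<subseteq> I) \<longrightarrow>
        (\<Sum>m\<in>Poly_Mapping.keys P.
           poly_mapping.lookup P m * (\<Prod>i\<in>Poly_Mapping.keys m. y i ^ poly_mapping.lookup m i)) = 0 \<longrightarrow> P = 0)"

definition is_seed :: "'f::field set \<Rightarrow> 'f seed \<Rightarrow> bool" where
  "is_seed K S \<longleftrightarrow>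
     (\<forall>i j. arrows S i j \<noteq> 0 \<longrightarrow> i \<in> vertices S \<and> j \<in> vertices S) \<and>
     (\<forall>i. arrows S i i = 0) \<and>
     (\<forall>i j. arrows S i j = 0 \<or> arrows S j i = 0) \<and>
     frozen S \<subseteq> vertices S \<and>
     (\<forall>i\<in>vertices S. (\<forall>j. arrows S i j = 0 \<and> arrows S j i = 0) \<longrightarrow> i \<in> frozen S) \<and>
     alg_independent K (vertices S) (cluster S) \<and>
     generate_field ring_of_type_algebra (K \<union> cluster S ` vertices S) = UNIV"

text \<open>Quiver mutation as the composite of its three steps; cancellation is truncated subtraction.\<close>

definition add_composites :: "nat \<Rightarrow> (nat \<Rightarrow> nat \<Rightarrow> nat) \<Rightarrow> nat \<Rightarrow> nat \<Rightarrow> nat" where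
  "add_composites l q i j = q i j + q i l * q l j"

definition reverse_at :: "nat \<Rightarrow> (nat \<Rightarrow> nat \<Rightarrow> nat) \<Rightarrow> nat \<Rightarrow> nat \<Rightarrow> nat" where
  "reverse_at l q i j = (if i = l \<or> j = l then q j i else q i j)"

definition cancel_2cycles :: "(nat \<Rightarrow> nat \<Rightarrow> nat) \<Rightarrow> nat \<Rightarrow> nat \<Rightarrow> nat" where
  "cancel_2cycles q i j = q i j - q j i"

definition mutate :: "nat \<Rightarrow> 'f::field seed \<Rightarrow> 'f seed" where
  "mutate l S = S\<lparr>
     arrows := cancel_2cycles (reverse_at l (add_composites l (arrows S))),
     cluster := (cluster S)(l :=
       ((\<Prod>i\<in>vertices S. cluster S i ^ arrows S i l) +
        (\<Prod>i\<in>vertices S. cluster S i ^ arrows S l i)) * inverse (cluster S l))\<rparr>"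

text \<open>
  Mutation at a fixed vertex is an involution on seeds, so reachability by mutations is already
  an equivalence relation on them.
\<close>

inductive mutation_equiv :: "'f::field seed \<Rightarrow> 'f seed \<Rightarrow> bool" for S where
  refl: "mutation_equiv S S"
| step: "mutation_equiv S T \<Longrightarrow> l \<in> mutable T \<Longrightarrow> mutation_equiv S (mutate l T)"

definition laurent_ring :: "'f::field set \<Rightarrow> 'f seed \<Rightarrow> 'f set" where
  "laurent_ring K S = generate_ring ring_of_type_algebra
     (K \<union> cluster S ` vertices S \<union> (\<lambda>i. inverse (cluster S i)) ` vertices S)"

definition upper_cluster_algebra :: "'f::field set \<Rightarrow> 'f seed \<Rightarrow> 'f set" where
  "upper_cluster_algebra K S = (\<Inter>T\<in>{T. mutation_equiv S T}. laurent_ring K T)"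

definition markov_arrows :: "nat \<Rightarrow> nat \<Rightarrow> nat" where
  "markov_arrows i j = (if (i, j) \<in> {(1, 2), (2, 3), (3, 1)} then 2 else 0)"

definition markov_seed :: "(nat \<Rightarrow> 'f) \<Rightarrow> 'f seed" where
  "markov_seed x = \<lparr>nverts = 3, arrows = markov_arrows, frozen = {}, cluster = x\<rparr>"


section \<open>Frobenius notions\<close>

text \<open>
  Here \<open>R\<close> is a subring of a field \<open>'f\<close> of positive characteristic. An algebraic closure of
  \<open>'f\<close> contains one of the fraction field of \<open>R\<close>, and this smaller field contains all
  \<open>p\<close>-power roots of elements of \<open>R\<close>; hence these roots may be taken in \<^typ>\<open>'f alg_closure\<close>,
  with \<^const>\<open>to_ac\<close> the inclusion of \<open>'f\<close>. They are unique, as Frobenius is injective.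
\<close>

definition frob_root :: "nat \<Rightarrow> 'f::field \<Rightarrow> 'f alg_closure" where
  "frob_root e x = (THE y. y ^ (CHAR('f) ^ e) = to_ac x)"

definition frob_roots :: "nat \<Rightarrow> 'f::field set \<Rightarrow> 'f alg_closure set" where
  "frob_roots e R = {y. y ^ (CHAR('f) ^ e) \<in> to_ac ` R}"

definition F_finite :: "'f::field set \<Rightarrow> bool" where
  "F_finite R \<longleftrightarrow>
     (\<exists>B. finite B \<and> B \<subseteq> frob_roots 1 R \<and>
        (\<forall>y\<in>frob_roots 1 R. \<exists>c. c ` B \<subseteq> R \<and> y = (\<Sum>b\<in>B. to_ac (c b) * b)))"

text \<open>Only the values on \<^term>\<open>frob_roots e R\<close> of a member of \<open>frob_hom e R\<close> are meaningful.\<close>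

definition frob_hom :: "nat \<Rightarrow> 'f::field set \<Rightarrow> ('f alg_closure \<Rightarrow> 'f) set" where
  "frob_hom e R = {\<psi>.
     (\<forall>y\<in>frob_roots e R. \<psi> y \<in> R) \<and>
     (\<forall>y\<in>frob_roots e R. \<forall>z\<in>frob_roots e R. \<psi> (y + z) = \<psi> y + \<psi> z) \<and>
     (\<forall>r\<in>R. \<forall>y\<in>frob_roots e R. \<psi> (to_ac r * y) = r * \<psi> y)}"

definition strongly_F_regular :: "'f::field set \<Rightarrow> bool" where
  "strongly_F_regular R \<longleftrightarrow>
     CHAR('f) > 0 \<and> subdomain R ring_of_type_algebra \<and> F_finite R \<and>
     (\<forall>x\<in>R. x \<noteq> 0 \<longrightarrow> (\<exists>e. \<exists>\<psi>\<in>frob_hom e R. \<psi> (frob_root e x) = 1))"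

end

(*
Write P = y^2 + z^2 and M = (x^2 + y^2 + z^2) / (x y z). The element M is invariant under
mutation, and the upper cluster algebra is A = K[x, y, z, M]. That A lies in every Laurent ring
follows from x' = M y z - x. Conversely, an element of the Laurent rings of the initial seed and
of its mutation at x has, for every d, a coefficient of x^-d divisible by P^d; such Laurent
polynomials form a ring E_x, and the intersection of E_x, E_y and E_z is A: if x g is in A and g in
E_x, then g is in A, because modulo x every element of A is a polynomial in M over K[y] + K[y] z,
whose lowest coefficient in x can only be divisible by enough powers of P if it vanishes.

The log volume form dx dy dz / (x y z) is a generator of the canonical module of A, so the Frobenius
trace that keeps the monomials with exponents divisible by q (and takes their roots) generates the
Frobenius dual of A. It preserves each of E_x, E_y, E_z, hence A. Given a nonzero element of A, a trace
with q larger than the spread of its exponents sends a multiple of it to a power of x y z. The trace of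
x y z M^3 is the coefficient 6, which is invertible as p is neither 2 nor 3; iterating, powers of x y z
are sent to 1.
*)

theory Submission
  imports Defs
begin

section \<open>Subrings and additive spans\<close>

text \<open>The exchange rings \<open>E_x\<close>, rather than the mutated Laurent rings, carry the
  argument because a monomial trace respects them: a factor \<open>P^(mq)\<close> leaves the trace
  as \<open>P^m\<close>, just as an exponent \<open>-mq\<close> of \<open>x\<close> becomes
  \<open>-m\<close>, so the required divisibility survives. Divisibility by \<open>P\<close> is
  tested in \<open>z\<close>: \<open>P\<close> is monic of degree 2 there, so a nonzero element with
  \<open>z\<close>-exponents 0 and 1 only is no multiple of it. Linear maps on \<open>q\<close>-th
  roots are replaced by additive self-maps with \<open>\<Phi> (r^q * s) = r * \<Phi> s\<close>, so
  the splittings are built without roots. Since \<open>K\<close> need not be perfect, a trace also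
  needs a functional on coefficients, chosen to be 1 at the coefficient to be isolated. The monomial
  that moves an isolated term to exponent 0 need not lie in \<open>A\<close>; this is why a power of
  \<open>x y z\<close> is multiplied in and must itself be sent to 1. Each argument singles out
  \<open>x\<close>; the cyclic symmetry of the Markov quiver supplies the ones for \<open>y\<close>
  and \<open>z\<close>.\<close>

abbreviation rgen :: "'a::field set \<Rightarrow> 'a set" where
  "rgen \<equiv> generate_ring ring_of_type_algebra"

lemma rta_simps [simp]:
  "carrier (ring_of_type_algebra :: 'a::field ring) = UNIV"
  "\<one>\<^bsub>ring_of_type_algebra :: 'a ring\<^esub> = 1"
  "\<zero>\<^bsub>ring_of_type_algebra :: 'a ring\<^esub> = 0"
  "(a::'a) \<oplus>\<^bsub>ring_of_type_algebra\<^esub> b = a + b"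
  "(a::'a) \<otimes>\<^bsub>ring_of_type_algebra\<^esub> b = a * b"
  by (simp_all add: ring_of_type_algebra_def)

lemma rta_a_inv [simp]: "\<ominus>\<^bsub>ring_of_type_algebra\<^esub> (a::'a::field) = - a"
proof -
  interpret R: ring "ring_of_type_algebra :: 'a ring" by (rule ring_from_type_algebra)
  show ?thesis
    by (rule R.minus_equality) simp_all
qed

lemma rgen_incl: "a \<in> S \<Longrightarrow> a \<in> rgen S"
  by (rule generate_ring.incl)

lemma rgen_1 [simp]: "1 \<in> rgen S"
  using generate_ring.one[of ring_of_type_algebra S] by simp

lemma rgen_uminus: "a \<in> rgen S \<Longrightarrow> - a \<in> rgen S"
  using generate_ring.a_inv[of a ring_of_type_algebra S] by simp

lemma rgen_add: "a \<in> rgen S \<Longrightarrow> b \<in> rgen S \<Longrightarrow> a + b \<in> rgen S"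
  using generate_ring.eng_add[of a ring_of_type_algebra S b] by simp

lemma rgen_mult: "a \<in> rgen S \<Longrightarrow> b \<in> rgen S \<Longrightarrow> a * b \<in> rgen S"
  using generate_ring.eng_mult[of a ring_of_type_algebra S b] by simp

lemma rgen_diff: "a \<in> rgen S \<Longrightarrow> b \<in> rgen S \<Longrightarrow> a - b \<in> rgen S"
  using rgen_add[of a S "- b"] rgen_uminus[of b S] by simp

lemma rgen_0 [simp]: "0 \<in> rgen S"
  using rgen_diff[of 1 S 1] by simp

lemma rgen_power: "a \<in> rgen S \<Longrightarrow> a ^ n \<in> rgen S"
  by (induction n) (auto intro: rgen_mult)

lemma rgen_induct [consumes 1, case_names one incl uminus add mult]:
  assumes "a \<in> rgen S"
    and "P 1" and "\<And>h. h \<in> S \<Longrightarrow> P h"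
    and "\<And>h. h \<in> rgen S \<Longrightarrow> P h \<Longrightarrow> P (- h)"
    and "\<And>g h. g \<in> rgen S \<Longrightarrow> P g \<Longrightarrow> h \<in> rgen S \<Longrightarrow> P h \<Longrightarrow> P (g + h)"
    and "\<And>g h. g \<in> rgen S \<Longrightarrow> P g \<Longrightarrow> h \<in> rgen S \<Longrightarrow> P h \<Longrightarrow> P (g * h)"
  shows "P a"
  using assms(1) by (induction rule: generate_ring.induct) (simp_all add: assms(2-))

lemma rgen_subset: "S \<subseteq> rgen T \<Longrightarrow> rgen S \<subseteq> rgen T"
proof
  fix a assume "S \<subseteq> rgen T" "a \<in> rgen S"
  show "a \<in> rgen T" using \<open>a \<in> rgen S\<close>
    by (induction rule: rgen_induct)
      (use \<open>S \<subseteq> rgen T\<close> in \<open>auto intro: rgen_uminus rgen_add rgen_mult\<close>)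
qed

lemma subdomain_rgen: "subdomain (rgen S) ring_of_type_algebra"
proof -
  interpret R: field "ring_of_type_algebra :: 'a ring" by (rule field_from_type_algebra)
  show ?thesis
    by (rule R.subdomainI', rule R.generate_ring_is_subring) simp
qed

text \<open>Finite sums are built one generator at a time, which gives the induction used for every
  spanning set below. There are no scalars: coefficients and signs have to be part of the
  generators.\<close>

inductive_set addspan :: "'a::ab_group_add set \<Rightarrow> 'a set" for S where
  zero [simp]: "0 \<in> addspan S"
| step: "s \<in> S \<Longrightarrow> t \<in> addspan S \<Longrightarrow> s + t \<in> addspan S"

lemma addspan_base: "s \<in> S \<Longrightarrow> s \<in> addspan S"
  using addspan.step[of s S 0] by simp

lemma addspan_add: "s \<in> addspan S \<Longrightarrow> t \<in> addspan S \<Longrightarrow> s + t \<in> addspan S"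
  by (induction rule: addspan.induct) (auto simp: add.assoc intro: addspan.step)

lemma addspan_mono: "S \<subseteq> T \<Longrightarrow> s \<in> addspan S \<Longrightarrow> s \<in> addspan T"
  by (rotate_tac 1, induction rule: addspan.induct) (auto intro: addspan.step)

lemma addspan_sum: "(\<And>i. i \<in> I \<Longrightarrow> f i \<in> addspan S) \<Longrightarrow> sum f I \<in> addspan S"
  by (induction I rule: infinite_finite_induct) (auto intro: addspan_add)

lemma addspan_uminus:
  assumes "\<And>s. s \<in> S \<Longrightarrow> - s \<in> S" "s \<in> addspan S"
  shows "- s \<in> addspan S"
  using assms(2)
proof (induction rule: addspan.induct)
  case (step s t)
  have "- s + - t \<in> addspan S"
    by (rule addspan.step) (use step assms(1) in auto)
  then show ?case by simp
qed simp

lemma addspan_diff: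
  assumes "\<And>s. s \<in> S \<Longrightarrow> - s \<in> S" "s \<in> addspan S" "t \<in> addspan S"
  shows "s - t \<in> addspan S"
  using addspan_add[OF assms(2) addspan_uminus[OF assms(1,3)]] by simp

lemma addspan_mult:
  fixes a b :: "'a::comm_ring_1"
  assumes "\<And>s t. s \<in> S \<Longrightarrow> t \<in> T \<Longrightarrow> s * t \<in> addspan V"
    and "a \<in> addspan S" "b \<in> addspan T"
  shows "a * b \<in> addspan V"
  using assms(2)
proof (induction rule: addspan.induct)
  case (step s u)
  have "s * b \<in> addspan V"
    using assms(3) by (induction rule: addspan.induct)
      (auto simp: distrib_left intro: addspan_add assms(1) step.hyps)
  then show ?case using step.IH by (auto simp: distrib_right intro: addspan_add)
qed simp

text \<open>Products of generators stay generators, so the finite sums already form a ring. This is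
  how a generated ring gets an explicit form for its elements.\<close>

lemma rgen_subset_addspan:
  fixes S :: "'a::field set"
  assumes "1 \<in> S" "\<And>s. s \<in> S \<Longrightarrow> - s \<in> S" "\<And>s t. s \<in> S \<Longrightarrow> t \<in> S \<Longrightarrow> s * t \<in> S" "G \<subseteq> S"
  shows "rgen G \<subseteq> addspan S"
proof
  fix a assume "a \<in> rgen G"
  then show "a \<in> addspan S"
  proof (induction rule: rgen_induct)
    case (mult g h)
    show ?case by (rule addspan_mult[OF _ mult.IH]) (auto intro: addspan_base assms)
  qed (use assms in \<open>auto intro: addspan_base addspan_uminus addspan_add\<close>)
qed

lemma subfield_closed:
  assumes "subfield K (ring_of_type_algebra :: 'a::field ring)"
  shows "0 \<in> K" "1 \<in> K" "a \<in> K \<Longrightarrow> - a \<in> K" "a \<in> K \<Longrightarrow> b \<in> K \<Longrightarrow> a + b \<in> K"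
    "a \<in> K \<Longrightarrow> b \<in> K \<Longrightarrow> a - b \<in> K" "a \<in> K \<Longrightarrow> b \<in> K \<Longrightarrow> a * b \<in> K" "a \<in> K \<Longrightarrow> inverse a \<in> K"
    "a \<in> K \<Longrightarrow> a ^ n \<in> K"
proof -
  interpret R: field "ring_of_type_algebra :: 'a ring" by (rule field_from_type_algebra)
  interpret K: subfield K "ring_of_type_algebra :: 'a ring" by fact
  note E = subringE[OF K.subring_axioms]
  show 0: "0 \<in> K" and 1: "1 \<in> K" using E by auto
  show u: "a \<in> K \<Longrightarrow> - a \<in> K" for a using E(5)[of a] by simp
  show p: "a \<in> K \<Longrightarrow> b \<in> K \<Longrightarrow> a + b \<in> K" for a b using E(7)[of a b] by simp
  show "a \<in> K \<Longrightarrow> b \<in> K \<Longrightarrow> a - b \<in> K" using p[of a "- b"] u[of b] by simp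
  show m: "a \<in> K \<Longrightarrow> b \<in> K \<Longrightarrow> a * b \<in> K" for a b using E(6)[of a b] by simp
  show "a \<in> K \<Longrightarrow> a ^ n \<in> K" by (induction n) (auto intro: 1 m)
  show "inverse a \<in> K" if a: "a \<in> K"
  proof (cases "a = 0")
    case False
    then have "a \<in> Units (ring_of_type_algebra\<lparr>carrier := K\<rparr>)"
      using K.subfield_Units a by simp
    then obtain b where "b \<in> K" "a * b = 1" unfolding Units_def by auto
    moreover from this have "b = inverse a" using False by (simp add: field_simps)
    ultimately show ?thesis by simp
  qed (use 0 in simp)
qed

section \<open>Laurent polynomials in three variables\<close>

text \<open>Independence is required of Laurent monomials, with integer exponents, so that the
  coefficients of an element are unique at once and the condition can be carried along rotation and
  mutation of the three variables.\<close>

locale laurent3 =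
  fixes K :: "'f::field set" and x y z :: 'f
  assumes subfield_K: "subfield K ring_of_type_algebra"
    and nonzero: "x \<noteq> 0" "y \<noteq> 0" "z \<noteq> 0"
    and indep: "\<And>F k m. finite F \<Longrightarrow> (\<And>m. m \<in> F \<Longrightarrow> k m \<in> K) \<Longrightarrow>
      (\<Sum>(a, b, c)\<in>F. k (a, b, c) * (x powi a * y powi b * z powi c)) = 0 \<Longrightarrow>
      m \<in> F \<Longrightarrow> k m = 0"
begin

lemmas K_closed = subfield_closed[OF subfield_K]

definition mon :: "int \<times> int \<times> int \<Rightarrow> 'f" where
  "mon = (\<lambda>(a, b, c). x powi a * y powi b * z powi c)"

lemma mon_mult: "mon (a, b, c) * mon (a', b', c') = mon (a + a', b + b', c + c')"
  using nonzero by (simp add: mon_def power_int_add mult_ac)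

lemma mon_power: "mon (a, b, c) ^ n = mon (a * int n, b * int n, c * int n)"
  by (simp add: mon_def power_mult_distrib power_int_power')

lemma mon_nonzero: "mon m \<noteq> 0"
  using nonzero by (cases m) (simp add: mon_def)

lemma mon_0: "mon (0, 0, 0) = 1"
  by (simp add: mon_def)

lemma indep_mon:
  assumes "finite F" "\<And>m. m \<in> F \<Longrightarrow> k m \<in> K" "(\<Sum>m\<in>F. k m * mon m) = 0" "m \<in> F"
  shows "k m = 0"
proof (rule indep[OF assms(1,2) _ assms(4)])
  show "(\<Sum>(a, b, c)\<in>F. k (a, b, c) * (x powi a * y powi b * z powi c)) = 0"
    using assms(3) by (simp add: mon_def case_prod_unfold)
qed

definition mons :: "(int \<times> int \<times> int) set \<Rightarrow> 'f set" where
  "mons D = {k * mon m | k m. k \<in> K \<and> m \<in> D}"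

definition Lspan :: "(int \<times> int \<times> int) set \<Rightarrow> 'f set" where
  "Lspan D = addspan (mons D)"

abbreviation "L \<equiv> Lspan UNIV"

lemma monsI: "k \<in> K \<Longrightarrow> m \<in> D \<Longrightarrow> k * mon m \<in> mons D"
  unfolding mons_def by blast

lemma LspanI: "k \<in> K \<Longrightarrow> m \<in> D \<Longrightarrow> k * mon m \<in> Lspan D"
  unfolding Lspan_def by (intro addspan_base monsI)

lemma mon_in_Lspan: "m \<in> D \<Longrightarrow> mon m \<in> Lspan D"
  using LspanI[of 1 m D] K_closed by simp

lemma Lspan_induct [consumes 1, case_names zero step]:
  assumes "g \<in> Lspan D" "P 0"
    "\<And>k a b c g. k \<in> K \<Longrightarrow> (a, b, c) \<in> D \<Longrightarrow> g \<in> Lspan D \<Longrightarrow> P g \<Longrightarrow> P (k * mon (a, b, c) + g)"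
  shows "P g"
  using assms(1) unfolding Lspan_def
proof (induction rule: addspan.induct)
  case (step s t)
  then obtain k a b c where "s = k * mon (a, b, c)" "k \<in> K" "(a, b, c) \<in> D"
    unfolding mons_def by (auto split: prod.splits)
  then show ?case using step assms(3) by (auto simp: Lspan_def)
qed (rule assms(2))

lemma Lspan_0 [simp]: "0 \<in> Lspan D"
  by (simp add: Lspan_def)

lemma Lspan_add: "g \<in> Lspan D \<Longrightarrow> h \<in> Lspan D \<Longrightarrow> g + h \<in> Lspan D"
  unfolding Lspan_def by (rule addspan_add)

lemma mons_uminus: "s \<in> mons D \<Longrightarrow> - s \<in> mons D"
proof -
  assume "s \<in> mons D"
  then obtain k m where "s = k * mon m" "k \<in> K" "m \<in> D" unfolding mons_def by blast
  then show ?thesis using monsI[of "- k" m D] K_closed(3) by simp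
qed

lemma Lspan_diff: "g \<in> Lspan D \<Longrightarrow> h \<in> Lspan D \<Longrightarrow> g - h \<in> Lspan D"
  unfolding Lspan_def by (intro addspan_diff mons_uminus)

lemma Lspan_sum: "(\<And>i. i \<in> I \<Longrightarrow> f i \<in> Lspan D) \<Longrightarrow> sum f I \<in> Lspan D"
  unfolding Lspan_def by (rule addspan_sum)

lemma Lspan_mono: "g \<in> Lspan D \<Longrightarrow> D \<subseteq> D' \<Longrightarrow> g \<in> Lspan D'"
  unfolding Lspan_def by (erule addspan_mono[rotated]) (unfold mons_def, blast)

lemma Lspan_mult:
  assumes "g \<in> Lspan D" "h \<in> Lspan D'"
    and "\<And>a b c a' b' c'. (a, b, c) \<in> D \<Longrightarrow> (a', b', c') \<in> D' \<Longrightarrow> (a + a', b + b', c + c') \<in> D''"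
  shows "g * h \<in> Lspan D''"
  unfolding Lspan_def
proof (rule addspan_mult)
  fix s t assume "s \<in> mons D" "t \<in> mons D'"
  then obtain k a b c k' a' b' c' where st: "s = k * mon (a, b, c)" "t = k' * mon (a', b', c')"
    and "k \<in> K" "k' \<in> K" "(a, b, c) \<in> D" "(a', b', c') \<in> D'"
    unfolding mons_def by auto
  then have "s * t = (k * k') * mon (a + a', b + b', c + c')"
    by (simp flip: mon_mult)
  then show "s * t \<in> addspan (mons D'')"
    using assms(3) \<open>k \<in> K\<close> \<open>k' \<in> K\<close> \<open>(a, b, c) \<in> D\<close> \<open>(a', b', c') \<in> D'\<close>
    by (auto intro!: addspan_base monsI K_closed)
qed (use assms in \<open>auto simp: Lspan_def\<close>)

lemma L_mult: "g \<in> L \<Longrightarrow> h \<in> L \<Longrightarrow> g * h \<in> L"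
  by (rule Lspan_mult) auto

lemma L_K: "k \<in> K \<Longrightarrow> k \<in> L"
  using LspanI[of k "(0, 0, 0)" UNIV] by (simp add: mon_0)

lemma L_power: "g \<in> L \<Longrightarrow> g ^ n \<in> L"
  by (induction n) (auto intro: L_mult L_K K_closed)

lemma L_eq_rgen: "L = rgen (K \<union> {x, y, z} \<union> {inverse x, inverse y, inverse z})"
proof
  define G where "G = K \<union> {x, y, z} \<union> {inverse x, inverse y, inverse z}"
  have x: "x powi a \<in> rgen G" "y powi a \<in> rgen G" "z powi a \<in> rgen G" for a
    unfolding power_int_def by (auto intro!: rgen_power intro: rgen_incl simp: G_def)
  show "L \<subseteq> rgen (K \<union> {x, y, z} \<union> {inverse x, inverse y, inverse z})"
    unfolding G_def[symmetric]
  proof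
    fix g assume "g \<in> L"
    then show "g \<in> rgen G"
    proof (induction rule: Lspan_induct)
      case (step k a b c g)
      moreover have "k \<in> rgen G" using step by (auto simp: G_def intro: rgen_incl)
      ultimately show ?case unfolding mon_def by (auto intro!: rgen_add rgen_mult x)
    qed simp
  qed
  have "s * t \<in> mons UNIV" if st: "s \<in> mons UNIV" "t \<in> mons UNIV" for s t
  proof -
    obtain k a b c k' a' b' c' where st: "s = k * mon (a, b, c)" "t = k' * mon (a', b', c')"
      and "k \<in> K" "k' \<in> K" using st unfolding mons_def by auto
    then have "s * t = (k * k') * mon (a + a', b + b', c + c')"
      by (simp flip: mon_mult)
    then show ?thesis using K_closed \<open>k \<in> K\<close> \<open>k' \<in> K\<close> by (auto intro!: monsI)
  qed
  moreover have "k * mon m \<in> mons UNIV" if "k \<in> K" for k m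
    using that by (rule monsI) simp
  from this[of 1 "(1,0,0)"] this[of 1 "(0,1,0)"] this[of 1 "(0,0,1)"]
    this[of 1 "(-1,0,0)"] this[of 1 "(0,-1,0)"] this[of 1 "(0,0,-1)"] this[of _ "(0,0,0)"]
  have "K \<union> {x, y, z} \<union> {inverse x, inverse y, inverse z} \<subseteq> mons UNIV"
    using K_closed by (auto simp: mon_def power_int_minus)
  ultimately show "rgen (K \<union> {x, y, z} \<union> {inverse x, inverse y, inverse z}) \<subseteq> L"
    unfolding Lspan_def by (intro rgen_subset_addspan) (use K_closed in \<open>auto intro: mons_uminus\<close>)
qed

section \<open>Unique coefficients and the parts of an element with given exponents\<close>

definition rep :: "'f \<Rightarrow> (int \<times> int \<times> int \<Rightarrow> 'f) \<Rightarrow> bool" where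
  "rep g k \<longleftrightarrow> finite {m. k m \<noteq> 0} \<and> (\<forall>m. k m \<in> K) \<and> g = (\<Sum>m | k m \<noteq> 0. k m * mon m)"

lemma rep_sum:
  fixes h :: "int \<times> int \<times> int \<Rightarrow> 'f \<Rightarrow> 'f"
  assumes "finite F" "{m. k m \<noteq> 0} \<subseteq> F" "\<And>m. h m 0 = 0"
  shows "(\<Sum>m | k m \<noteq> 0. h m (k m)) = (\<Sum>m\<in>F. h m (k m))"
  by (rule sum.mono_neutral_left) (use assms in auto)

lemma rep_add:
  assumes "rep g k" "rep g' k'"
  shows "rep (g + g') (\<lambda>m. k m + k' m)"
proof -
  let ?F = "{m. k m \<noteq> 0} \<union> {m. k' m \<noteq> 0}"
  have "finite ?F" using assms by (auto simp: rep_def)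
  moreover from this have "finite {m. k m + k' m \<noteq> 0}" by (rule rev_finite_subset) auto
  moreover have "{m. k m + k' m \<noteq> 0} \<subseteq> ?F" by auto
  ultimately have "(\<Sum>m | k m + k' m \<noteq> 0. (k m + k' m) * mon m) = g + g'"
    using assms rep_sum[of ?F k "\<lambda>m u. u * mon m"] rep_sum[of ?F k' "\<lambda>m u. u * mon m"]
      rep_sum[of ?F "\<lambda>m. k m + k' m" "\<lambda>m u. u * mon m"]
    by (simp add: rep_def distrib_right sum.distrib)
  then show ?thesis
    using assms \<open>finite {m. k m + k' m \<noteq> 0}\<close> by (simp add: rep_def K_closed)
qed

lemma rep_mon: "k \<in> K \<Longrightarrow> rep (k * mon m) (\<lambda>m'. if m' = m then k else 0)"
proof -
  assume k: "k \<in> K"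
  have sub: "{m'. (if m' = m then k else 0) \<noteq> 0} \<subseteq> {m}" by auto
  show ?thesis
    using rep_sum[OF _ sub, of "\<lambda>m u. u * mon m"] finite_subset[OF sub] k
    unfolding rep_def by (simp add: K_closed)
qed

lemma rep_unique:
  assumes "rep g k" "rep g k'"
  shows "k = k'"
proof
  fix m
  let ?F = "insert m ({m. k m \<noteq> 0} \<union> {m. k' m \<noteq> 0})"
  have F: "finite ?F" using assms by (auto simp: rep_def)
  moreover have "{m. k m \<noteq> 0} \<subseteq> ?F" "{m. k' m \<noteq> 0} \<subseteq> ?F" by auto
  ultimately have "(\<Sum>m\<in>?F. k m * mon m) = (\<Sum>m\<in>?F. k' m * mon m)"
    using assms rep_sum[of ?F k "\<lambda>m u. u * mon m"] rep_sum[of ?F k' "\<lambda>m u. u * mon m"]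
    unfolding rep_def by simp
  then have "(\<Sum>m\<in>?F. (k m - k' m) * mon m) = 0"
    by (simp add: left_diff_distrib sum_subtractf)
  from indep_mon[OF F _ this, of m] show "k m = k' m"
    using assms by (auto simp: rep_def K_closed)
qed

lemma rep_exists: "g \<in> L \<Longrightarrow> \<exists>k. rep g k"
proof (induction rule: Lspan_induct)
  case zero
  have "rep 0 (\<lambda>_. 0)" by (simp add: rep_def K_closed)
  then show ?case by (rule exI[of _ "\<lambda>_. 0"])
next
  case (step k a b c g)
  then show ?case using rep_add[OF rep_mon] by meson
qed

text \<open>Unique expansions let a rule for single terms extend to sums. Only additivity in the
  coefficient is asked, not \<open>K\<close>-linearity, because the rule for a Frobenius trace is
  not \<open>K\<close>-linear.\<close>

lemma additive_extension:
  assumes h: "\<And>m k l. k \<in> K \<Longrightarrow> l \<in> K \<Longrightarrow> h m (k + l) = h m k + h m l"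
  shows "\<exists>\<Phi>. (\<forall>g\<in>L. \<forall>g'\<in>L. \<Phi> (g + g') = \<Phi> g + \<Phi> g') \<and> (\<forall>k\<in>K. \<forall>m. \<Phi> (k * mon m) = (h m k :: 'f))"
proof -
  have h0: "h m 0 = 0" for m using h[OF K_closed(1) K_closed(1), of m] by (simp only: add_0_right add_cancel_right_right)
  define \<Phi> where "\<Phi> g = (\<Sum>m | (THE k. rep g k) m \<noteq> 0. h m ((THE k. rep g k) m))" for g
  have \<Phi>: "\<Phi> g = (\<Sum>m | k m \<noteq> 0. h m (k m))" if "rep g k" for g k
  proof -
    have "(THE k. rep g k) = k" using that rep_unique by blast
    then show ?thesis by (simp add: \<Phi>_def)
  qed
  have "\<Phi> (g + g') = \<Phi> g + \<Phi> g'" if g: "g \<in> L" "g' \<in> L" for g g'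
  proof -
    obtain k k' where kk: "rep g k" "rep g' k'" using rep_exists[OF g(1)] rep_exists[OF g(2)] by blast
    let ?F = "{m. k m \<noteq> 0} \<union> {m. k' m \<noteq> 0}"
    have "finite ?F" using kk by (simp add: rep_def)
    moreover have "{m. k m \<noteq> 0} \<subseteq> ?F" "{m. k' m \<noteq> 0} \<subseteq> ?F" "{m. k m + k' m \<noteq> 0} \<subseteq> ?F" by auto
    moreover have "k m \<in> K" "k' m \<in> K" for m using kk unfolding rep_def by blast+
    ultimately show ?thesis
      using rep_sum[of ?F k h, OF _ _ h0] rep_sum[of ?F k' h, OF _ _ h0]
        rep_sum[of ?F "\<lambda>m. k m + k' m" h, OF _ _ h0]
      by (simp add: \<Phi>[OF rep_add[OF kk]] \<Phi>[OF kk(1)] \<Phi>[OF kk(2)] h sum.distrib)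
  qed
  moreover have "\<Phi> (k * mon m) = h m k" if "k \<in> K" for k m
  proof -
    have "\<Phi> (k * mon m) = (\<Sum>m' | (if m' = m then k else 0) \<noteq> 0. h m' (if m' = m then k else 0))"
      by (rule \<Phi>[OF rep_mon[OF that]])
    also have "\<dots> = (\<Sum>m'\<in>{m}. h m' (if m' = m then k else 0))"
      by (rule rep_sum) (auto simp: h0)
    finally show ?thesis by simp
  qed
  ultimately show ?thesis by blast
qed

text \<open>A grading component of the Laurent ring when \<open>D\<close> fixes one exponent. Only
  the values on \<open>L\<close> are pinned down by the choice.\<close>

definition proj :: "(int \<times> int \<times> int) set \<Rightarrow> 'f \<Rightarrow> 'f" where
  "proj D = (SOME \<Phi>. (\<forall>g\<in>L. \<forall>g'\<in>L. \<Phi> (g + g') = \<Phi> g + \<Phi> g') \<and>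
     (\<forall>k\<in>K. \<forall>m. \<Phi> (k * mon m) = (if m \<in> D then k * mon m else 0)))"

lemma proj_aux:
  "(\<forall>g\<in>L. \<forall>g'\<in>L. proj D (g + g') = proj D g + proj D g') \<and>
     (\<forall>k\<in>K. \<forall>m. proj D (k * mon m) = (if m \<in> D then k * mon m else 0))"
  using someI_ex[OF additive_extension[of "\<lambda>m k. if m \<in> D then k * mon m else 0"]]
  unfolding proj_def by (simp add: distrib_right)

lemma proj_add: "g \<in> L \<Longrightarrow> g' \<in> L \<Longrightarrow> proj D (g + g') = proj D g + proj D g'"
  using proj_aux by blast

lemma proj_mon: "k \<in> K \<Longrightarrow> proj D (k * mon m) = (if m \<in> D then k * mon m else 0)"
  using proj_aux by blast

lemma proj_0 [simp]: "proj D 0 = 0"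
  using proj_add[OF Lspan_0 Lspan_0, of D] by (simp only: add_0_right add_cancel_right_right)

lemma Lspan_L: "g \<in> Lspan D \<Longrightarrow> g \<in> L"
  by (erule Lspan_mono) simp

lemma L_mon [intro]: "k \<in> K \<Longrightarrow> k * mon m \<in> L"
  by (rule LspanI) simp_all

lemma proj_sum: "(\<And>i. i \<in> I \<Longrightarrow> f i \<in> L) \<Longrightarrow> proj D (sum f I) = (\<Sum>i\<in>I. proj D (f i))"
  by (induction I rule: infinite_finite_induct) (auto simp: proj_add Lspan_sum)

lemma proj_in_Lspan: "g \<in> L \<Longrightarrow> proj D g \<in> Lspan D"
  by (induction rule: Lspan_induct) (auto simp: proj_add proj_mon L_mon intro!: Lspan_add LspanI)

lemma proj_same: "g \<in> Lspan D \<Longrightarrow> proj D g = g"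
  by (induction rule: Lspan_induct) (auto simp: proj_add proj_mon L_mon Lspan_L)

lemma proj_disjoint: "g \<in> Lspan D' \<Longrightarrow> D \<inter> D' = {} \<Longrightarrow> proj D g = 0"
  by (induction rule: Lspan_induct) (auto simp: proj_add proj_mon L_mon Lspan_L)

lemma proj_split: "g \<in> L \<Longrightarrow> g = proj D g + proj (- D) g"
  by (induction rule: Lspan_induct) (auto simp: proj_add proj_mon L_mon algebra_simps)

text \<open>Every exponent of \<open>h\<close> shifts \<open>D''\<close> into \<open>D\<close> and
  lets nothing else in, so picking terms commutes with multiplying by \<open>h\<close>. The typical
  \<open>h\<close> is homogeneous in one variable.\<close>

lemma proj_mult:
  assumes "g \<in> L" "h \<in> Lspan D'"
    and "\<And>a b c a' b' c'. (a', b', c') \<in> D' \<Longrightarrow> (a + a', b + b', c + c') \<in> D \<longleftrightarrow> (a, b, c) \<in> D''"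
  shows "proj D (g * h) = proj D'' g * h"
proof -
  have *: "proj D (k * mon (a, b, c) * h) = proj D'' (k * mon (a, b, c)) * h" if k: "k \<in> K" for k a b c
    using assms(2)
  proof (induction rule: Lspan_induct)
    case (step l a' b' c' h)
    have eq: "k * mon (a, b, c) * (l * mon (a', b', c')) = (k * l) * mon (a + a', b + b', c + c')"
      by (simp flip: mon_mult)
    have "proj D (k * mon (a, b, c) * (l * mon (a', b', c'))) = proj D'' (k * mon (a, b, c)) * (l * mon (a', b', c'))"
      unfolding eq using k step assms(3)[of a' b' c' a b c]
      by (simp add: proj_mon K_closed) (simp flip: mon_mult)
    then show ?case
      using step k by (simp add: distrib_left proj_add L_mult L_mon Lspan_L)
  qed simp
  show ?thesis
    using assms(1)
    by (induction rule: Lspan_induct)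
      (simp_all add: * distrib_right proj_add L_mult L_mon Lspan_L[OF assms(2)])
qed

lemma K_subset_Lspan: "k \<in> K \<Longrightarrow> (0, 0, 0) \<in> D \<Longrightarrow> k \<in> Lspan D"
  using LspanI[of k "(0, 0, 0)" D] by (simp add: mon_0)

lemma Lspan_finite: "g \<in> L \<Longrightarrow> \<exists>F. finite F \<and> g \<in> Lspan F"
proof (induction rule: Lspan_induct)
  case (step k a b c g)
  then obtain F where "finite F" "g \<in> Lspan F" by blast
  then have "finite (insert (a, b, c) F)" "k * mon (a, b, c) + g \<in> Lspan (insert (a, b, c) F)"
    using step by (auto intro!: Lspan_add LspanI intro: Lspan_mono[of g F])
  then show ?case by blast
qed auto

lemma proj_decomp:
  assumes "g \<in> Lspan F" "finite F"
  shows "g = (\<Sum>n\<in>f ` F. proj {m. f m = n} g)"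
  using assms(1)
proof (induction rule: Lspan_induct)
  case (step k a b c g)
  have "(\<Sum>n\<in>f ` F. proj {m. f m = n} (k * mon (a, b, c) + g)) =
      (\<Sum>n\<in>f ` F. proj {m. f m = n} (k * mon (a, b, c))) + (\<Sum>n\<in>f ` F. proj {m. f m = n} g)"
    using step by (simp add: proj_add L_mon Lspan_L sum.distrib)
  also have "(\<Sum>n\<in>f ` F. proj {m. f m = n} (k * mon (a, b, c))) =
      (\<Sum>n\<in>f ` F. if n = f (a, b, c) then k * mon (a, b, c) else 0)"
    using step by (intro sum.cong) (auto simp: proj_mon)
  also have "\<dots> = k * mon (a, b, c)"
    using step assms(2) by (subst sum.delta) auto
  finally show ?case using step.IH by simp
qed simp

section \<open>The exchange ring of the variable \<open>x\<close>\<close>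

definition P :: 'f where "P = y ^ 2 + z ^ 2"

lemma P_mon: "P = mon (0, 2, 0) + mon (0, 0, 2)"
  by (simp add: P_def mon_def)

lemma P_Lspan: "P \<in> Lspan {m. fst m = 0}"
  unfolding P_mon by (intro Lspan_add mon_in_Lspan) auto

lemma P_power_Lspan: "P ^ n \<in> Lspan {m. fst m = 0}"
proof (induction n)
  case (Suc n)
  show ?case unfolding power_Suc by (rule Lspan_mult[OF P_Lspan Suc]) auto
qed (use K_subset_Lspan[of 1] K_closed in auto)

lemma P_nonzero: "P \<noteq> 0"
proof
  assume "P = 0"
  then have "mon (0, 2, 0) + mon (0, 0, 2) = 0" by (simp add: P_mon)
  then have "proj {(0, 2, 0)} (1 * mon (0, 2, 0) + 1 * mon (0, 0, 2)) = 0" by simp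
  then have "mon (0, 2, 0) = 0"
    by (simp only: proj_add[OF L_mon[OF K_closed(2)] L_mon[OF K_closed(2)]] proj_mon[OF K_closed(2)]) simp
  then show False using mon_nonzero by blast
qed

text \<open>The elements of \<^term>\<open>L\<close> whose coefficient of \<open>x\<^sup>-\<^sup>d\<close> is divisible by \<open>P\<^sup>d\<close>, for all \<open>d\<close>.\<close>

definition exch_gens :: "'f set" where
  "exch_gens = {k * mon (a, b, c) * P ^ d | k a b c d. k \<in> K \<and> - a \<le> int d}"

definition exch_ring :: "'f set" where
  "exch_ring = addspan exch_gens"

lemma exch_gensI: "k \<in> K \<Longrightarrow> - a \<le> int d \<Longrightarrow> k * mon (a, b, c) * P ^ d \<in> exch_gens"
  unfolding exch_gens_def by blast

lemma exch_gens_uminus: "s \<in> exch_gens \<Longrightarrow> - s \<in> exch_gens"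
proof -
  assume "s \<in> exch_gens"
  then obtain k a b c d where "s = k * mon (a, b, c) * P ^ d" "k \<in> K" "- a \<le> int d"
    unfolding exch_gens_def by blast
  then show ?thesis using exch_gensI[of "- k" a d b c] K_closed(3) by simp
qed

lemma exch_gens_mult:
  assumes "s \<in> exch_gens" "t \<in> exch_gens"
  shows "s * t \<in> exch_gens"
proof -
  obtain k a b c d where s: "s = k * mon (a, b, c) * P ^ d" "k \<in> K" "- a \<le> int d"
    using assms(1) unfolding exch_gens_def by blast
  obtain k' a' b' c' d' where t: "t = k' * mon (a', b', c') * P ^ d'" "k' \<in> K" "- a' \<le> int d'"
    using assms(2) unfolding exch_gens_def by blast
  have "s * t = (k * k') * (mon (a, b, c) * mon (a', b', c')) * P ^ (d + d')"
    by (simp add: s t power_add)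
  also have "\<dots> = (k * k') * mon (a + a', b + b', c + c') * P ^ (d + d')"
    by (simp add: mon_mult)
  also have "\<dots> \<in> exch_gens"
    using s t by (intro exch_gensI K_closed) auto
  finally show ?thesis .
qed

lemma exch_ring_0 [simp]: "0 \<in> exch_ring"
  and exch_ring_gen: "s \<in> exch_gens \<Longrightarrow> s \<in> exch_ring"
  and exch_ring_add: "g \<in> exch_ring \<Longrightarrow> h \<in> exch_ring \<Longrightarrow> g + h \<in> exch_ring"
  and exch_ring_uminus: "g \<in> exch_ring \<Longrightarrow> - g \<in> exch_ring"
  and exch_ring_diff: "g \<in> exch_ring \<Longrightarrow> h \<in> exch_ring \<Longrightarrow> g - h \<in> exch_ring"
  unfolding exch_ring_def
  by (auto intro: addspan_base addspan_add addspan_uminus addspan_diff exch_gens_uminus)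

lemma exch_ring_mult: "g \<in> exch_ring \<Longrightarrow> h \<in> exch_ring \<Longrightarrow> g * h \<in> exch_ring"
  unfolding exch_ring_def by (erule addspan_mult[rotated]) (auto intro: addspan_base exch_gens_mult)

lemma exch_ring_induct [consumes 1, case_names zero step]:
  assumes "g \<in> exch_ring" "Q 0"
    "\<And>k a b c d g. k \<in> K \<Longrightarrow> - a \<le> int d \<Longrightarrow> g \<in> exch_ring \<Longrightarrow> Q g \<Longrightarrow> Q (k * mon (a, b, c) * P ^ d + g)"
  shows "Q g"
  using assms(1) unfolding exch_ring_def
proof (induction rule: addspan.induct)
  case (step s t)
  then obtain k a b c d where "s = k * mon (a, b, c) * P ^ d" "k \<in> K" "- a \<le> int d"
    unfolding exch_gens_def by blast
  then show ?case using step assms(3) by (auto simp: exch_ring_def)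
qed (rule assms(2))

lemma exch_gen_Lspan: "k \<in> K \<Longrightarrow> k * mon (a, b, c) * P ^ d \<in> Lspan {m. fst m = a}"
  by (rule Lspan_mult[OF LspanI[of k "(a, b, c)" "{m. fst m = a}"] P_power_Lspan]) auto

lemma exch_ring_L: "g \<in> exch_ring \<Longrightarrow> g \<in> L"
  by (induction rule: exch_ring_induct) (auto intro!: Lspan_add intro: Lspan_L exch_gen_Lspan)

lemma Lspan_nonneg_exch: "g \<in> Lspan {m. fst m \<ge> 0} \<Longrightarrow> g \<in> exch_ring"
proof (induction rule: Lspan_induct)
  case (step k a b c g)
  then show ?case using exch_gensI[of k a 0 b c] by (auto intro: exch_ring_add exch_ring_gen)
qed simp

lemma exch_ring_mon: "k \<in> K \<Longrightarrow> a \<ge> 0 \<Longrightarrow> k * mon (a, b, c) \<in> exch_ring"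
  by (intro Lspan_nonneg_exch LspanI) auto

lemma exch_ring_basic: "k \<in> K \<Longrightarrow> k \<in> exch_ring" "x \<in> exch_ring" "y \<in> exch_ring" "z \<in> exch_ring"
  using exch_ring_mon[of k 0 0 0] exch_ring_mon[of 1 1 0 0] exch_ring_mon[of 1 0 1 0]
    exch_ring_mon[of 1 0 0 1] K_closed by (simp_all add: mon_def)

lemma exch_ring_power: "g \<in> exch_ring \<Longrightarrow> g ^ n \<in> exch_ring"
  by (induction n) (auto intro: exch_ring_mult exch_ring_basic K_closed)

text \<open>Different \<open>x\<close>-degrees do not mix, since \<open>P\<close> is free of
  \<open>x\<close>. The part of degree \<open>-n\<close> comes from generators with
  \<open>a = -n\<close>, and these carry \<open>P ^ d\<close> with \<open>d \<ge> n\<close>.\<close>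

lemma proj_exch_ring:
  assumes "g \<in> exch_ring"
  shows "\<exists>h\<in>L. proj {m. fst m = - int n} g = P ^ n * h"
  using assms
proof (induction rule: exch_ring_induct)
  case zero
  show ?case by (rule bexI[of _ 0]) simp_all
next
  case (step k a b c d g)
  then obtain h where h: "h \<in> L" "proj {m. fst m = - int n} g = P ^ n * h" by blast
  note gen = exch_gen_Lspan[OF step.hyps(1), of a b c d]
  have eq: "proj {m. fst m = - int n} (k * mon (a, b, c) * P ^ d + g) =
      proj {m. fst m = - int n} (k * mon (a, b, c) * P ^ d) + P ^ n * h"
    using proj_add[OF Lspan_L[OF gen] exch_ring_L[OF step.hyps(3)]] h by simp
  show ?case
  proof (cases "a = - int n")
    case True
    then have "d = n + (d - n)" using step by simp
    then have "P ^ d = P ^ n * P ^ (d - n)" by (metis power_add)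
    then have "proj {m. fst m = - int n} (k * mon (a, b, c) * P ^ d) =
        P ^ n * (k * mon (a, b, c) * P ^ (d - n))"
      using proj_same[OF gen] True by simp
    then have "proj {m. fst m = - int n} (k * mon (a, b, c) * P ^ d + g) =
        P ^ n * (k * mon (a, b, c) * P ^ (d - n) + h)"
      unfolding eq by (simp add: distrib_left)
    moreover have "k * mon (a, b, c) * P ^ (d - n) + h \<in> L"
      by (intro Lspan_add h Lspan_L[OF exch_gen_Lspan] step)
    ultimately show ?thesis by blast
  next
    case False
    then have "proj {m. fst m = - int n} (k * mon (a, b, c) * P ^ d) = 0"
      by (intro proj_disjoint[OF gen]) auto
    then show ?thesis unfolding eq using h by auto
  qed
qed

text \<open>A monomial of the mutated cluster is \<open>x powi (- a) * P powi a\<close> times powers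
  of \<open>y\<close> and \<open>z\<close>. Those with \<open>a \<ge> 0\<close> lie in the exchange
  ring. The rest have positive \<open>x\<close>-degree with \<open>P\<close> in the denominator;
  their sum \<open>g2\<close> differs from \<open>g\<close> by an element of \<open>L\<close>, hence
  is a Laurent polynomial with only positive powers of \<open>x\<close>, and so lies in the exchange
  ring too.\<close>

lemma mutated_laurent_inter_exch:
  assumes "g \<in> L"
    and "g \<in> rgen (K \<union> {P * inverse x, y, z} \<union> {inverse (P * inverse x), inverse y, inverse z})"
  shows "g \<in> exch_ring"
proof -
  define S where "S = {k * mon (- a, b, c) * P powi a | k a b c. k \<in> K}"
  have SI: "k * mon (- a, b, c) * P powi a \<in> S" if "k \<in> K" for k a b c
    using that unfolding S_def by blast
  have "rgen (K \<union> {P * inverse x, y, z} \<union> {inverse (P * inverse x), inverse y, inverse z}) \<subseteq> addspan S"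
  proof (rule rgen_subset_addspan)
    show "1 \<in> S" using SI[of 1 0 0 0] K_closed by (simp add: mon_0)
    show "- s \<in> S" if s: "s \<in> S" for s
    proof -
      obtain k a b c where "s = k * mon (- a, b, c) * P powi a" "k \<in> K"
        using s unfolding S_def by blast
      then show ?thesis using SI[of "- k" a b c] K_closed(3) by simp
    qed
    show "s * t \<in> S" if st: "s \<in> S" "t \<in> S" for s t
    proof -
      obtain k a b c where s: "s = k * mon (- a, b, c) * P powi a" "k \<in> K"
        using st(1) unfolding S_def by blast
      obtain k' a' b' c' where t: "t = k' * mon (- a', b', c') * P powi a'" "k' \<in> K"
        using st(2) unfolding S_def by blast
      have "s * t = (k * k') * (mon (- a, b, c) * mon (- a', b', c')) * P powi (a + a')"
        by (simp add: s t power_int_add P_nonzero)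
      also have "\<dots> = (k * k') * mon (- (a + a'), b + b', c + c') * P powi (a + a')"
        by (simp add: mon_mult)
      finally show ?thesis using SI[OF K_closed(6)[OF s(2) t(2)]] by metis
    qed
    show "K \<union> {P * inverse x, y, z} \<union> {inverse (P * inverse x), inverse y, inverse z} \<subseteq> S"
      using SI[of _ 0 0 0] SI[of 1 1 0 0] SI[of 1 "-1" 0 0] SI[of 1 0 1 0] SI[of 1 0 0 1]
        SI[of 1 0 "-1" 0] SI[of 1 0 0 "-1"] K_closed
      by (auto simp: mon_def power_int_minus mult_ac)
  qed
  with assms(2) have "g \<in> addspan S" by blast
  then have "\<exists>g1\<in>exch_ring. \<exists>g2 N. g = g1 + g2 \<and> P ^ N * g2 \<in> Lspan {m. fst m > 0}"
  proof (induction rule: addspan.induct)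
    case zero
    show ?case by (rule bexI[of _ 0], rule exI[of _ 0]) simp_all
  next
    case (step s t)
    obtain k a b c where s: "s = k * mon (- a, b, c) * P powi a" "k \<in> K"
      using step.hyps(1) unfolding S_def by blast
    obtain g1 g2 N where g: "g1 \<in> exch_ring" "t = g1 + g2" "P ^ N * g2 \<in> Lspan {m. fst m > 0}"
      using step.IH by blast
    show ?case
    proof (cases "a \<ge> 0")
      case True
      then have eq: "s = k * mon (- a, b, c) * P ^ nat a" by (simp add: s power_int_nonneg_exp)
      have "s \<in> exch_ring"
        unfolding eq by (intro exch_ring_gen exch_gensI) (use s True in simp_all)
      then show ?thesis using g by (metis add.assoc exch_ring_add)
    next
      case False
      then have "P ^ nat (- a) * P powi a = 1"
        using P_nonzero by (simp add: power_int_def power_inverse)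
      then have "P ^ nat (- a) * s = k * mon (- a, b, c)"
        by (simp add: s mult_ac)
      moreover have "P ^ N * (k * mon (- a, b, c)) \<in> Lspan {m. fst m > 0}"
        by (rule Lspan_mult[OF P_power_Lspan LspanI[of k _ "{m. fst m > 0}"]]) (use s False in auto)
      moreover have "P ^ nat (- a) * (P ^ N * g2) \<in> Lspan {m. fst m > 0}"
        by (rule Lspan_mult[OF P_power_Lspan g(3)]) auto
      ultimately have "P ^ N * (P ^ nat (- a) * s) + P ^ nat (- a) * (P ^ N * g2) \<in> Lspan {m. fst m > 0}"
        by (auto intro: Lspan_add)
      then have "P ^ (N + nat (- a)) * (s + g2) \<in> Lspan {m. fst m > 0}"
        by (simp add: power_add algebra_simps)
      moreover have "s + t = g1 + (s + g2)" using g by simp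
      ultimately show ?thesis using g by blast
    qed
  qed
  then obtain g1 g2 N where g: "g1 \<in> exch_ring" "g = g1 + g2" "P ^ N * g2 \<in> Lspan {m. fst m > 0}"
    by blast
  have g2: "g2 \<in> L"
    using Lspan_diff[OF assms(1) exch_ring_L[OF g(1)]] g(2) by simp
  \<comment> \<open>\<open>P\<close> has \<open>x\<close>-degree 0, so multiplying by
    \<open>P ^ N\<close> cannot hide a term of degree at most 0 in \<open>g2\<close>.\<close>
  have "proj {m. fst m \<le> 0} (g2 * P ^ N) = proj {m. fst m \<le> 0} g2 * P ^ N"
    by (rule proj_mult[OF g2 P_power_Lspan]) auto
  moreover have "proj {m. fst m \<le> 0} (P ^ N * g2) = 0"
    by (rule proj_disjoint[OF g(3)]) auto
  ultimately have "proj {m. fst m \<le> 0} g2 = 0"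
    using P_nonzero by (simp add: mult.commute)
  then have "g2 = proj (- {m. fst m \<le> 0}) g2" using proj_split[OF g2, of "{m. fst m \<le> 0}"] by simp
  then have "g2 \<in> Lspan (- {m. fst m \<le> 0})" using proj_in_Lspan[OF g2] by metis
  then have "g2 \<in> exch_ring" by (intro Lspan_nonneg_exch) (erule Lspan_mono, auto)
  then show ?thesis using g exch_ring_add by simp
qed

section \<open>Remainders modulo \<open>P\<close>, the invariant \<open>M\<close> and the ring
  \<open>A\<close>\<close>

definition Dz :: "(int \<times> int \<times> int) set" where
  "Dz = {m. fst m = 0 \<and> snd (snd m) \<in> {0, 1}}"

text \<open>\<open>Dz\<close> holds the exponents of remainders for division by \<open>P\<close> as
  a polynomial in \<open>z\<close>; the exponent of \<open>y\<close> is any integer. With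
  \<open>q n\<close> the part of \<open>r\<close> of \<open>z\<close>-degree \<open>n\<close>, the
  equation \<open>w = P * r\<close> links \<open>q n\<close> to \<open>q (n - 2)\<close> in every
  degree other than 0 and 1. As \<open>r\<close> is a finite sum, vanishing propagates down from
  large degrees and up from very negative ones, leaving \<open>r = 0\<close>.\<close>

lemma linear_multiple_of_P:
  assumes "w \<in> Lspan Dz" "r \<in> L" "w = P * r"
  shows "w = 0"
proof -
  define q where "q n = proj {m. snd (snd m) = n} r" for n :: int
  have rec: "q n * mon (0, 2, 0) + q (n - 2) * mon (0, 0, 2) = 0" if "n \<noteq> 0" "n \<noteq> 1" for n
  proof -
    have "proj {m. snd (snd m) = n} w = 0"
      by (rule proj_disjoint[OF assms(1)]) (use that in \<open>auto simp: Dz_def\<close>)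
    moreover have "w = r * mon (0, 2, 0) + r * mon (0, 0, 2)"
      by (simp add: assms(3) P_mon algebra_simps)
    moreover have "proj {m. snd (snd m) = n} (r * mon (0, 2, 0)) = q n * mon (0, 2, 0)"
      unfolding q_def by (rule proj_mult[OF assms(2) mon_in_Lspan[of _ "{(0, 2, 0)}"]]) auto
    moreover have "proj {m. snd (snd m) = n} (r * mon (0, 0, 2)) = q (n - 2) * mon (0, 0, 2)"
      unfolding q_def by (rule proj_mult[OF assms(2) mon_in_Lspan[of _ "{(0, 0, 2)}"]]) auto
    ultimately show ?thesis
      using assms(2) by (simp add: proj_add L_mult mon_in_Lspan)
  qed
  obtain F where F: "finite F" "r \<in> Lspan F" using Lspan_finite[OF assms(2)] by blast
  have "finite ((\<lambda>m. \<bar>snd (snd m)\<bar>) ` F)" using F by simp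
  then obtain N where N: "\<And>m. m \<in> F \<Longrightarrow> \<bar>snd (snd m)\<bar> \<le> N"
    by (metis Max_ge imageI)
  have big: "q n = 0" if "\<bar>n\<bar> > N" for n
    unfolding q_def by (rule proj_disjoint[OF F(2)]) (use N that in force)
  have pos: "q n = 0" if "n \<ge> 0" "n + 2 * int j > N" for n j
    using that
  proof (induction j arbitrary: n)
    case 0
    then show ?case using big by simp
  next
    case (Suc j)
    then have "q (n + 2) = 0" by simp
    with rec[of "n + 2"] Suc.prems show ?case using mon_nonzero by auto
  qed
  have neg: "q n = 0" if "n < 0" "- n + 2 * int j > N" for n j
    using that
  proof (induction j arbitrary: n)
    case 0
    then show ?case using big by simp
  next
    case (Suc j)
    then have "q (n - 2) = 0" by simp
    with rec[of n] Suc.prems show ?case using mon_nonzero by auto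
  qed
  have "q n = 0" for n
    using pos[of n "nat (N - n + 1)"] neg[of n "nat (N + n + 1)"] by (cases "n \<ge> 0") auto
  then have "r = 0"
    using proj_decomp[OF F(2,1), of "\<lambda>m. snd (snd m)"] unfolding q_def by simp
  then show ?thesis using assms(3) by simp
qed

text \<open>The quantity conserved by mutation in the Markov equation
  \<open>x^2 + y^2 + z^2 = 3xyz\<close>, with \<open>M\<close> in the place of the constant
  3.\<close>

definition M :: 'f where
  "M = (x ^ 2 + y ^ 2 + z ^ 2) * inverse (x * y * z)"

definition A :: "'f set" where
  "A = rgen (K \<union> {x, y, z, M})"

lemma M_rel: "M * x * y * z = x ^ 2 + y ^ 2 + z ^ 2"
  using nonzero by (simp add: M_def field_simps)

text \<open>Sorted by \<open>x\<close>-degree: the lowest degree is -1, with a coefficient divisible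
  by \<open>P\<close> once, which is exactly what the exchange ring allows.\<close>

lemma M_mon: "M = mon (1, -1, -1) + mon (-1, -1, -1) * P"
  using nonzero by (simp add: M_def mon_def P_def power_int_minus field_simps power2_eq_square)

lemma M_exch: "M \<in> exch_ring"
  unfolding M_mon using exch_ring_mon[of 1 1 "-1" "-1"] exch_gensI[of 1 "-1" 1 "-1" "-1"] K_closed
  by (intro exch_ring_add) (simp_all add: exch_ring_gen)

lemma A_gens: "k \<in> K \<Longrightarrow> k \<in> A" "x \<in> A" "y \<in> A" "z \<in> A" "M \<in> A"
  unfolding A_def by (auto intro: rgen_incl)

lemma A_exch: "g \<in> A \<Longrightarrow> g \<in> exch_ring"
  unfolding A_def
  by (induction rule: rgen_induct)
    (auto intro: exch_ring_basic K_closed M_exch exch_ring_uminus exch_ring_add exch_ring_mult)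

text \<open>Only the term \<open>mon (-1, -1, -1) * P\<close> of \<open>M\<close> lowers the
  \<open>x\<close>-degree, so the lowest part of a power of \<open>M\<close> is the power of that
  term.\<close>

lemma M_power_lowest:
  "M ^ d - mon (- int d, - int d, - int d) * P ^ d \<in> Lspan {m. fst m > - int d}"
proof (induction d)
  case 0
  show ?case by (simp add: mon_0)
next
  case (Suc d)
  let ?l = "\<lambda>d. mon (- int d, - int d, - int d) * P ^ d"
  have l: "?l d \<in> Lspan {m. fst m \<ge> - int d}"
    using exch_gen_Lspan[of 1 "- int d" "- int d" "- int d" d] K_closed
    by (auto intro: Lspan_mono)
  have l1: "mon (-1, -1, -1) * P \<in> Lspan {m. fst m \<ge> - 1}"
    using exch_gen_Lspan[of 1 "-1" "-1" "-1" 1] K_closed by (auto intro: Lspan_mono)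
  have ls: "?l (Suc d) = mon (-1, -1, -1) * P * ?l d"
    using mon_mult[of "-1" "-1" "-1" "- int d" "- int d" "- int d"] by (simp add: mult_ac)
  have "M ^ Suc d - ?l (Suc d) =
      mon (-1, -1, -1) * P * (M ^ d - ?l d) + mon (1, -1, -1) * (M ^ d - ?l d) + mon (1, -1, -1) * ?l d"
    unfolding ls by (simp add: M_mon[symmetric] algebra_simps) (subst M_mon, simp add: algebra_simps)
  moreover have "mon (-1, -1, -1) * P * (M ^ d - ?l d) \<in> Lspan {m. fst m > - int (Suc d)}"
    by (rule Lspan_mult[OF l1 Suc]) auto
  moreover have "mon (1, -1, -1) * (M ^ d - ?l d) \<in> Lspan {m. fst m > - int (Suc d)}"
    by (rule Lspan_mult[OF mon_in_Lspan[of _ "{(1, -1, -1)}"] Suc]) auto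
  moreover have "mon (1, -1, -1) * ?l d \<in> Lspan {m. fst m > - int (Suc d)}"
    by (rule Lspan_mult[OF mon_in_Lspan[of _ "{(1, -1, -1)}"] l]) auto
  ultimately show ?case by (metis Lspan_add)
qed

lemma M_power_Lspan: "M ^ d \<in> Lspan {m. fst m \<ge> - int d}"
proof -
  have "mon (- int d, - int d, - int d) * P ^ d \<in> Lspan {m. fst m \<ge> - int d}"
    using exch_gen_Lspan[of 1 "- int d" "- int d" "- int d" d] K_closed
    by (auto intro: Lspan_mono)
  moreover have "M ^ d - mon (- int d, - int d, - int d) * P ^ d \<in> Lspan {m. fst m \<ge> - int d}"
    by (rule Lspan_mono[OF M_power_lowest]) auto
  ultimately show ?thesis using Lspan_add by fastforce
qed

text \<open>
  Compares the coefficient of the lowest power of \<^term>\<open>x\<close>: it comes from the top power of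
  \<^term>\<open>M\<close> alone.
\<close>

lemma M_polynomial_divisible:
  assumes "\<And>d. w d \<in> Lspan Dz" "(\<Sum>d<D. w d * M ^ d) * mon (-1, 0, 0) \<in> exch_ring"
  shows "(\<Sum>d<D. w d * M ^ d) = 0"
  using assms(2)
proof (induction D)
  case (Suc D)
  let ?H = "{m. fst m > - int (Suc D)}" and ?E = "{m. fst m = - int (Suc D)}"
  let ?e = "M ^ D - mon (- int D, - int D, - int D) * P ^ D"
  \<comment> \<open>The \<open>x\<close>-exponent is \<open>- int (Suc D)\<close> and not
    \<open>- int D\<close> because of the division by \<open>x\<close>. The exchange ring thus
    demands one more factor \<open>P\<close> than the \<open>P ^ D\<close> already present, and
    \<open>w D\<close> has to supply it.\<close>
  define lead where "lead = w D * (mon (- int (Suc D), - int D, - int D) * P ^ D)"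
  define rest where "rest = (\<Sum>d<D. w d * M ^ d * mon (-1, 0, 0)) + w D * ?e * mon (-1, 0, 0)"
  have m: "mon (-1, 0, 0) \<in> Lspan {m. fst m = -1}" by (rule mon_in_Lspan) simp
  have "w d * M ^ d * mon (-1, 0, 0) \<in> Lspan ?H" if "d < D" for d
    by (rule Lspan_mult[OF Lspan_mult[OF assms(1) M_power_Lspan, of d "{m. fst m \<ge> - int d}" d] m])
      (use that in \<open>auto simp: Dz_def\<close>)
  moreover have "w D * ?e * mon (-1, 0, 0) \<in> Lspan ?H"
    by (rule Lspan_mult[OF Lspan_mult[OF assms(1) M_power_lowest, of D "{m. fst m > - int D}" D] m])
      (auto simp: Dz_def)
  ultimately have rest: "rest \<in> Lspan ?H"
    unfolding rest_def by (intro Lspan_add Lspan_sum) auto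
  have "mon (- int (Suc D), - int D, - int D) * P ^ D \<in> Lspan ?E"
    using exch_gen_Lspan[of 1 "- int (Suc D)" "- int D" "- int D" D] K_closed by simp
  then have lead: "lead \<in> Lspan ?E"
    unfolding lead_def by (rule Lspan_mult[OF assms(1)]) (auto simp: Dz_def)
  have "mon (- int (Suc D), - int D, - int D) = mon (- int D, - int D, - int D) * mon (-1, 0, 0)"
    by (simp add: mon_mult diff_diff_eq2 algebra_simps)
  then have split: "(\<Sum>d<Suc D. w d * M ^ d) * mon (-1, 0, 0) = lead + rest"
    by (simp add: lead_def rest_def algebra_simps sum_distrib_left sum_distrib_right)
  have "proj ?E (lead + rest) = proj ?E lead + proj ?E rest"
    by (rule proj_add[OF Lspan_L[OF lead] Lspan_L[OF rest]])
  also have "proj ?E rest = 0"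
    by (rule proj_disjoint[OF rest]) auto
  also have "proj ?E lead + 0 = lead"
    using proj_same[OF lead] by simp
  finally obtain h where h: "h \<in> L" "lead = P ^ Suc D * h"
    using proj_exch_ring[OF Suc.prems, of "Suc D"] unfolding split by auto
  have "mon (- int (Suc D), - int D, - int D) * mon (int (Suc D), int D, int D) = 1"
    by (simp add: mon_mult mon_0)
  then have "w D * P ^ D = lead * mon (int (Suc D), int D, int D)"
    by (simp add: lead_def mult_ac)
  also have "\<dots> = P ^ D * (P * (h * mon (int (Suc D), int D, int D)))"
    by (simp add: h mult_ac)
  finally have "w D = P * (h * mon (int (Suc D), int D, int D))"
    using P_nonzero by simp
  moreover have "h * mon (int (Suc D), int D, int D) \<in> L"
    by (rule L_mult[OF h(1) mon_in_Lspan]) simp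
  \<comment> \<open>A remainder divisible by \<open>P\<close> vanishes, so the top power of
    \<open>M\<close> drops out and the induction hypothesis applies to the shorter sum.\<close>
  ultimately have "w D = 0"
    using linear_multiple_of_P[OF assms(1)] by blast
  then show ?case using Suc by simp
qed simp

section \<open>Normal forms modulo \<open>x\<close> and division by \<open>x\<close> in
  \<open>A\<close>\<close>

definition Mpoly :: "'f set" where
  "Mpoly = addspan {w * M ^ d | w d. w \<in> Lspan Dz}"

lemma Mpoly_sum:
  assumes "g \<in> Mpoly"
  shows "\<exists>D w. (\<forall>d. w d \<in> Lspan Dz) \<and> g = (\<Sum>d<D. w d * M ^ d)"
  using assms unfolding Mpoly_def
proof (induction rule: addspan.induct)
  case zero
  show ?case by (rule exI[of _ 0], rule exI[of _ "\<lambda>_. 0"]) simp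
next
  case (step s t)
  then obtain D w v e where w: "\<And>d. w d \<in> Lspan Dz" "t = (\<Sum>d<D. w d * M ^ d)"
    and v: "v \<in> Lspan Dz" "s = v * M ^ e" by blast
  define D' where "D' = max D (Suc e)"
  define w' where "w' d = (if d = e then v else 0) + (if d < D then w d else 0)" for d
  have "(\<Sum>d<D'. w' d * M ^ d) = (\<Sum>d<D'. if d = e then v * M ^ e else 0) + (\<Sum>d<D'. if d < D then w d * M ^ d else 0)"
    unfolding sum.distrib[symmetric] w'_def by (intro sum.cong) (auto simp: algebra_simps)
  also have "(\<Sum>d<D'. if d = e then v * M ^ e else 0) = s"
    using v by (subst sum.delta) (auto simp: D'_def)
  also have "(\<Sum>d<D'. if d < D then w d * M ^ d else 0) = t"
    unfolding w by (rule sum.mono_neutral_cong_right) (auto simp: D'_def)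
  finally have "s + t = (\<Sum>d<D'. w' d * M ^ d)" by simp
  moreover have "w' d \<in> Lspan Dz" for d
    unfolding w'_def by (intro Lspan_add) (auto simp: v w)
  ultimately show ?case by blast
qed

lemma A_mult: "g \<in> A \<Longrightarrow> h \<in> A \<Longrightarrow> g * h \<in> A"
  and A_add: "g \<in> A \<Longrightarrow> h \<in> A \<Longrightarrow> g + h \<in> A"
  and A_diff: "g \<in> A \<Longrightarrow> h \<in> A \<Longrightarrow> g - h \<in> A"
  and A_power: "g \<in> A \<Longrightarrow> g ^ n \<in> A"
  and A_0 [simp]: "0 \<in> A"
  unfolding A_def by (auto intro: rgen_mult rgen_add rgen_diff rgen_power)

text \<open>The relation for \<open>M\<close> reads \<open>z^2 = x * (M * y * z - x) - y^2\<close>,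
  so modulo \<open>x\<close> every \<open>z^2\<close> can be traded for \<open>- y^2\<close>. The
  exponent of \<open>z\<close> falls by 2 until it is 0 or 1.\<close>

lemma A_normal_form_monomial:
  assumes "k \<in> K"
  shows "\<exists>a\<in>A. \<exists>g\<in>Mpoly. k * y ^ b * z ^ c * M ^ d = x * a + g"
  using assms
proof (induction c arbitrary: k b rule: less_induct)
  case (less c)
  show ?case
  proof (cases "c < 2")
    case True
    then have c: "int c \<in> {0, 1}" by auto
    have "k * y ^ b * z ^ c = k * mon (0, int b, int c)"
      by (simp add: mon_def)
    moreover have "k * mon (0, int b, int c) \<in> Lspan Dz"
      using c less.prems by (intro LspanI) (simp_all add: Dz_def)
    ultimately have "k * y ^ b * z ^ c * M ^ d \<in> Mpoly"
      unfolding Mpoly_def by (metis (mono_tags, lifting) addspan_base mem_Collect_eq)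
    then show ?thesis by (intro bexI[of _ 0] bexI[of _ "k * y ^ b * z ^ c * M ^ d"]) simp_all
  next
    case False
    define e where "e = c - 2"
    have c: "c = e + 2" using False by (simp add: e_def)
    obtain a g where ag: "a \<in> A" "g \<in> Mpoly" "(- k) * y ^ (b + 2) * z ^ e * M ^ d = x * a + g"
      using less.IH[of e "- k" "b + 2"] less.prems K_closed(3) c by auto
    have "z ^ 2 = x * (M * y * z - x) - y ^ 2"
      using M_rel by (simp add: algebra_simps power2_eq_square)
    moreover have "k * y ^ b * z ^ c * M ^ d = k * y ^ b * z ^ e * M ^ d * z ^ 2"
      by (simp only: c power_add mult_ac)
    ultimately have "k * y ^ b * z ^ c * M ^ d = k * y ^ b * z ^ e * M ^ d * (x * (M * y * z - x) - y ^ 2)"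
      by (simp only:)
    also have "\<dots> = x * (k * y ^ b * z ^ e * M ^ d * (M * y * z - x)) + (- k) * y ^ (b + 2) * z ^ e * M ^ d"
      by (simp add: power_add right_diff_distrib mult_ac power2_eq_square)
    also have "\<dots> = x * (k * y ^ b * z ^ e * M ^ d * (M * y * z - x) + a) + g"
      unfolding ag(3) by (simp add: algebra_simps)
    moreover have "k * y ^ b * z ^ e * M ^ d * (M * y * z - x) + a \<in> A"
      by (intro A_add A_mult A_power A_diff A_gens ag less.prems)
    ultimately show ?thesis using ag(2) by metis
  qed
qed

lemma A_normal_form:
  assumes "c \<in> A"
  shows "\<exists>a\<in>A. \<exists>g\<in>Mpoly. c = x * a + g"
proof -
  define S where "S = {k * x ^ i * y ^ j * z ^ l * M ^ d | k i j l d. k \<in> K}"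
  have SI: "k * x ^ i * y ^ j * z ^ l * M ^ d \<in> S" if "k \<in> K" for k i j l d
    using that unfolding S_def by blast
  have "A \<subseteq> addspan S" unfolding A_def
  proof (rule rgen_subset_addspan)
    show "1 \<in> S" using SI[of 1 0 0 0 0] K_closed by simp
    show "- s \<in> S" if s: "s \<in> S" for s
    proof -
      obtain k i j l d where "s = k * x ^ i * y ^ j * z ^ l * M ^ d" "k \<in> K"
        using s unfolding S_def by blast
      then show ?thesis using SI[of "- k" i j l d] K_closed(3) by simp
    qed
    show "s * t \<in> S" if st: "s \<in> S" "t \<in> S" for s t
    proof -
      obtain k i j l d where s: "s = k * x ^ i * y ^ j * z ^ l * M ^ d" "k \<in> K"
        using st(1) unfolding S_def by blast
      obtain k' i' j' l' d' where t: "t = k' * x ^ i' * y ^ j' * z ^ l' * M ^ d'" "k' \<in> K"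
        using st(2) unfolding S_def by blast
      have "s * t = (k * k') * x ^ (i + i') * y ^ (j + j') * z ^ (l + l') * M ^ (d + d')"
        by (simp add: s t power_add mult_ac)
      then show ?thesis using SI[OF K_closed(6)[OF s(2) t(2)]] by metis
    qed
    show "K \<union> {x, y, z, M} \<subseteq> S"
      using SI[of _ 0 0 0 0] SI[of 1 1 0 0 0] SI[of 1 0 1 0 0] SI[of 1 0 0 1 0] SI[of 1 0 0 0 1] K_closed
      by auto
  qed
  with assms have "c \<in> addspan S" by blast
  then show ?thesis
  proof (induction rule: addspan.induct)
    case zero
    show ?case by (rule bexI[of _ 0], rule bexI[of _ 0]) (simp_all add: Mpoly_def)
  next
    case (step s t)
    obtain k i j l d where s: "s = k * x ^ i * y ^ j * z ^ l * M ^ d" "k \<in> K"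
      using step.hyps(1) unfolding S_def by blast
    have "\<exists>a\<in>A. \<exists>g\<in>Mpoly. s = x * a + g"
    proof (cases i)
      case 0
      then show ?thesis using A_normal_form_monomial[OF s(2), of j l d] s by simp
    next
      case (Suc i')
      then have "s = x * (k * x ^ i' * y ^ j * z ^ l * M ^ d) + 0" using s by simp
      moreover have "k * x ^ i' * y ^ j * z ^ l * M ^ d \<in> A"
        by (intro A_mult A_power A_gens s)
      moreover have "0 \<in> Mpoly" by (simp add: Mpoly_def)
      ultimately show ?thesis by blast
    qed
    then obtain a g where 1: "a \<in> A" "g \<in> Mpoly" "s = x * a + g" by blast
    obtain a' g' where 2: "a' \<in> A" "g' \<in> Mpoly" "t = x * a' + g'" using step.IH by blast
    have "s + t = x * (a + a') + (g + g')" by (simp add: 1 2 algebra_simps)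
    moreover have "g + g' \<in> Mpoly" using 1 2 by (simp add: Mpoly_def addspan_add)
    ultimately show ?case using A_add 1 2 by blast
  qed
qed

text \<open>Write \<open>x * g = x * a + h\<close> in normal form. Then \<open>h\<close> divided by
  \<open>x\<close> is \<open>g - a\<close>, which lies in the exchange ring, and a polynomial in
  \<open>M\<close> over the remainders allows this only if it is 0.\<close>

lemma A_divide_x:
  assumes "x * g \<in> A" "g \<in> exch_ring"
  shows "g \<in> A"
proof -
  obtain a h where ah: "a \<in> A" "h \<in> Mpoly" "x * g = x * a + h"
    using A_normal_form[OF assms(1)] by blast
  obtain D w where w: "\<And>d. w d \<in> Lspan Dz" "h = (\<Sum>d<D. w d * M ^ d)"
    using Mpoly_sum[OF ah(2)] by blast
  have "h * mon (-1, 0, 0) = g - a"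
    using ah(3) nonzero by (simp add: mon_def power_int_minus field_simps)
  then have "h * mon (-1, 0, 0) \<in> exch_ring"
    using assms(2) A_exch[OF ah(1)] by (simp add: exch_ring_diff)
  then have "h = 0" using M_polynomial_divisible[of w D] w by simp
  then show ?thesis using ah nonzero by simp
qed

lemma A_divide_x_power: "x ^ n * g \<in> A \<Longrightarrow> g \<in> exch_ring \<Longrightarrow> g \<in> A"
proof (induction n)
  case (Suc n)
  have "x ^ n * g \<in> exch_ring" using Suc.prems by (intro exch_ring_mult exch_ring_power exch_ring_basic(2))
  then have "x ^ n * g \<in> A" using A_divide_x[of "x ^ n * g"] Suc.prems by (simp add: mult.assoc)
  then show ?case using Suc by blast
qed simp

text \<open>Validity for all large \<open>n\<close>, rather than for one, lets the bounds of two
  summands be merged by a maximum and leaves the exponent free to be multiplied by \<open>q\<close>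
  later.\<close>

lemma clear_denominators: "g \<in> L \<Longrightarrow> \<exists>N. \<forall>n\<ge>N. x ^ n * y ^ n * z ^ n * g \<in> A"
proof (induction rule: Lspan_induct)
  case zero
  show ?case by simp
next
  case (step k a b c g)
  then obtain N where N: "\<And>n. n \<ge> N \<Longrightarrow> x ^ n * y ^ n * z ^ n * g \<in> A" by blast
  let ?N = "max N (nat (max \<bar>a\<bar> (max \<bar>b\<bar> \<bar>c\<bar>)))"
  have "x ^ n * y ^ n * z ^ n * (k * mon (a, b, c) + g) \<in> A" if n: "n \<ge> ?N" for n
  proof -
    have "x ^ n * y ^ n * z ^ n * mon (a, b, c) = mon (int n, int n, int n) * mon (a, b, c)"
      by (simp add: mon_def)
    also have "\<dots> = x ^ nat (int n + a) * y ^ nat (int n + b) * z ^ nat (int n + c)"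
    proof -
      have "0 \<le> int n + a" "0 \<le> int n + b" "0 \<le> int n + c" using n by auto
      then show ?thesis unfolding mon_mult by (simp add: mon_def power_int_nonneg_exp)
    qed
    finally have "x ^ n * y ^ n * z ^ n * (k * mon (a, b, c) + g) =
        k * (x ^ nat (int n + a) * y ^ nat (int n + b) * z ^ nat (int n + c)) + x ^ n * y ^ n * z ^ n * g"
      by (simp add: algebra_simps)
    moreover have "k * (x ^ nat (int n + a) * y ^ nat (int n + b) * z ^ nat (int n + c)) \<in> A"
      using step by (intro A_mult A_power A_gens)
    ultimately show ?thesis using N[of n] n by (simp add: A_add)
  qed
  then show ?case by blast
qed

end

section \<open>Frobenius-inverse linear maps\<close>

lemma frobenius_diff:
  fixes a b :: "'a::field"
  assumes "prime CHAR('a)" "q = CHAR('a) ^ e"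
  shows "(a - b) ^ q = a ^ q - b ^ q"
  using freshmans_dream'[OF assms, of "a - b" b] by simp

lemma frobenius_inj:
  fixes a b :: "'a::field"
  assumes "prime CHAR('a)" "q = CHAR('a) ^ e" "a ^ q = b ^ q"
  shows "a = b"
  using frobenius_diff[OF assms(1,2), of a b] assms by simp

text \<open>Taking \<open>q\<close>-th powers identifies the ring of \<open>q\<close>-th roots of
  \<open>R\<close> with \<open>R\<close>, a scalar \<open>r\<close> then acting as
  \<open>r ^ q\<close>. For \<open>q\<close> a power of the characteristic these maps are the
  \<open>R\<close>-linear maps from the \<open>q\<close>-th roots to \<open>R\<close>.\<close>

definition inv_linear :: "nat \<Rightarrow> 'a::field set \<Rightarrow> ('a \<Rightarrow> 'a) \<Rightarrow> bool" where
  "inv_linear q R \<Phi> \<longleftrightarrow> (\<forall>s\<in>R. \<Phi> s \<in> R) \<and> (\<forall>s\<in>R. \<forall>t\<in>R. \<Phi> (s + t) = \<Phi> s + \<Phi> t) \<and>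
     (\<forall>r\<in>R. \<forall>s\<in>R. \<Phi> (r ^ q * s) = r * \<Phi> s)"

lemma inv_linearD:
  assumes "inv_linear q R \<Phi>"
  shows "s \<in> R \<Longrightarrow> \<Phi> s \<in> R" "s \<in> R \<Longrightarrow> t \<in> R \<Longrightarrow> \<Phi> (s + t) = \<Phi> s + \<Phi> t"
    "r \<in> R \<Longrightarrow> s \<in> R \<Longrightarrow> \<Phi> (r ^ q * s) = r * \<Phi> s"
  using assms by (auto simp: inv_linear_def)

text \<open>From a factor \<open>r ^ (q * q')\<close> the inner map \<open>\<Phi>\<close> releases
  \<open>r ^ q'\<close> and the outer map \<open>\<Psi>\<close> then releases \<open>r\<close>;
  closure under powers makes \<open>r ^ q'\<close> a legitimate scalar.\<close>

lemma inv_linear_compose: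
  assumes "inv_linear q R \<Phi>" "inv_linear q' R \<Psi>" "\<And>r n. r \<in> R \<Longrightarrow> r ^ n \<in> R"
  shows "inv_linear (q * q') R (\<Psi> \<circ> \<Phi>)"
  using assms(1,2) unfolding inv_linear_def
  by (auto simp: mult.commute[of q q'] power_mult assms(3))

lemma inv_linear_premult:
  assumes "inv_linear q R \<Phi>" "w \<in> R" "\<And>r s. r \<in> R \<Longrightarrow> s \<in> R \<Longrightarrow> r * s \<in> R"
  shows "inv_linear q R (\<lambda>s. \<Phi> (w * s))"
proof -
  have "w * (r ^ q * s) = r ^ q * (w * s)" for r s by (simp only: mult.left_commute)
  then show ?thesis
    using assms unfolding inv_linear_def
    by (auto simp only: distrib_left)
qed

text \<open>
  A maximal \<open>K\<^sup>q\<close>-subspace \<open>H\<close> of \<open>K\<close> avoiding \<open>a\<close> is a complement of the line through \<open>a\<close>; the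
  coordinate along \<open>a\<close> is the required functional.
\<close>

lemma inv_linear_functional:
  fixes K :: "'a::field set"
  assumes K: "subfield K ring_of_type_algebra" and "prime CHAR('a)" "q = CHAR('a) ^ e"
    and a: "a \<in> K" "a \<noteq> 0"
  shows "\<exists>\<pi>. inv_linear q K \<pi> \<and> \<pi> a = 1"
proof -
  note K_closed = subfield_closed[OF K]
  note fr_diff = frobenius_diff[OF assms(2,3)]
  note fr_add = freshmans_dream'[OF assms(2,3)]
  have q: "q > 0" using assms(2,3) prime_gt_0_nat by simp
  define V where "V = {H. H \<subseteq> K \<and> 0 \<in> H \<and> (\<forall>s\<in>H. \<forall>t\<in>H. s - t \<in> H) \<and>
    (\<forall>r\<in>K. \<forall>s\<in>H. r ^ q * s \<in> H) \<and> a \<notin> H}"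
  have "\<exists>W\<in>V. \<forall>E\<in>V. W \<subseteq> E \<longrightarrow> E = W"
  proof (rule subset_Zorn_nonempty)
    have "{0} \<in> V" using a K_closed q by (auto simp: V_def)
    then show "V \<noteq> {}" by blast
    fix C assume C: "C \<noteq> {}" "subset.chain V C"
    have CV: "\<And>E. E \<in> C \<Longrightarrow> E \<in> V" using C(2) by (auto simp: subset_chain_def)
    have "s - t \<in> \<Union>C" if st: "s \<in> \<Union>C" "t \<in> \<Union>C" for s t
    proof -
      obtain E F where EF: "E \<in> C" "F \<in> C" "s \<in> E" "t \<in> F" using st by blast
      then have "E \<subseteq> F \<or> F \<subseteq> E" using C(2) by (auto simp: subset_chain_def)
      then obtain G where "G \<in> C" "s \<in> G" "t \<in> G" using EF by blast
      then show ?thesis using CV[of G] by (auto simp: V_def)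
    qed
    moreover have "\<Union>C \<subseteq> K" "a \<notin> \<Union>C"
    proof -
      have "G \<subseteq> K \<and> a \<notin> G" if "G \<in> C" for G using CV[OF that] by (simp add: V_def)
      then show "\<Union>C \<subseteq> K" "a \<notin> \<Union>C" by blast+
    qed
    moreover have "0 \<in> \<Union>C" using C(1) CV by (auto simp: V_def)
    moreover have "r ^ q * s \<in> \<Union>C" if rs: "r \<in> K" "s \<in> \<Union>C" for r s
    proof -
      obtain G where G: "G \<in> C" "s \<in> G" using rs(2) by blast
      then have "r ^ q * s \<in> G" using CV[OF G(1)] rs(1) by (simp add: V_def)
      then show ?thesis using G(1) by blast
    qed
    ultimately show "\<Union>C \<in> V" by (simp add: V_def)
  qed
  then obtain H where H: "H \<in> V" and max: "\<And>E. E \<in> V \<Longrightarrow> H \<subseteq> E \<Longrightarrow> E = H" by blast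
  have HK: "H \<subseteq> K" and H0: "0 \<in> H" and Hd: "\<And>s t. s \<in> H \<Longrightarrow> t \<in> H \<Longrightarrow> s - t \<in> H"
    and Hm: "\<And>r s. r \<in> K \<Longrightarrow> s \<in> H \<Longrightarrow> r ^ q * s \<in> H" and Ha: "a \<notin> H"
    using H by (auto simp: V_def)
  have Hn: "- s \<in> H" if "s \<in> H" for s using Hd[OF H0 that] by simp
  have Hp: "s + t \<in> H" if "s \<in> H" "t \<in> H" for s t using Hd[OF that(1) Hn[OF that(2)]] by simp
  have ex: "\<exists>t\<in>K. s - t ^ q * a \<in> H" if s: "s \<in> K" for s
  proof (cases "s \<in> H")
    case True
    then show ?thesis using q K_closed by (intro bexI[of _ 0]) (auto simp: zero_power)
  next
    case False
    \<comment> \<open>If \<open>s\<close> is outside \<open>H\<close>, adjoining it gives a strictly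
      larger subspace, which contains \<open>a\<close> by maximality. Solving
      \<open>a = h + r ^ q * s\<close> for \<open>s\<close> gives the multiple of \<open>a\<close>
      congruent to \<open>s\<close> modulo \<open>H\<close>.\<close>
    define E where "E = {h + r ^ q * s | h r. h \<in> H \<and> r \<in> K}"
    have EI: "h + r ^ q * s \<in> E" if "h \<in> H" "r \<in> K" for h r using that unfolding E_def by blast
    have "H \<subseteq> E" using EI[of _ 0] q K_closed by (auto simp: zero_power)
    moreover have "s \<in> E" using EI[of 0 1] H0 K_closed by simp
    ultimately have "E \<notin> V" using max False by blast
    moreover have "E \<subseteq> K"
    proof
      fix u assume "u \<in> E"
      then obtain h r where "u = h + r ^ q * s" "h \<in> H" "r \<in> K" unfolding E_def by blast
      then show "u \<in> K" using HK s by (auto intro!: K_closed)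
    qed
    moreover have "0 \<in> E" using \<open>H \<subseteq> E\<close> H0 by blast
    moreover have "u - v \<in> E" if uv: "u \<in> E" "v \<in> E" for u v
    proof -
      obtain h r where u: "u = h + r ^ q * s" "h \<in> H" "r \<in> K" using uv(1) unfolding E_def by blast
      obtain h' r' where v: "v = h' + r' ^ q * s" "h' \<in> H" "r' \<in> K" using uv(2) unfolding E_def by blast
      have "u - v = (h - h') + (r - r') ^ q * s" by (simp add: u v fr_diff algebra_simps)
      then show ?thesis using EI[OF Hd[OF u(2) v(2)] K_closed(5)[OF u(3) v(3)]] by metis
    qed
    moreover have "r ^ q * u \<in> E" if ru: "r \<in> K" "u \<in> E" for r u
    proof -
      obtain h r' where u: "u = h + r' ^ q * s" "h \<in> H" "r' \<in> K" using ru(2) unfolding E_def by blast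
      have "r ^ q * u = r ^ q * h + (r * r') ^ q * s" by (simp add: u power_mult_distrib algebra_simps)
      then show ?thesis using EI[OF Hm[OF ru(1) u(2)] K_closed(6)[OF ru(1) u(3)]] by metis
    qed
    ultimately have "a \<in> E" by (auto simp: V_def)
    then obtain h r where hr: "a = h + r ^ q * s" "h \<in> H" "r \<in> K" unfolding E_def by blast
    have r: "r \<noteq> 0" using hr Ha q by (auto simp: zero_power)
    then have "s - inverse r ^ q * a = - (inverse r ^ q * h)"
      by (simp add: hr(1) power_inverse field_simps)
    also have "\<dots> \<in> H" by (rule Hn[OF Hm[OF K_closed(7)[OF hr(3)] hr(2)]])
    finally show ?thesis by (rule bexI) (rule K_closed(7)[OF hr(3)])
  qed
  have uniq: "t = t'" if t: "t \<in> K" "t' \<in> K" "s - t ^ q * a \<in> H" "s - t' ^ q * a \<in> H" for s t t'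
  proof (rule ccontr)
    assume "t \<noteq> t'"
    \<comment> \<open>Two different coordinates would put a nonzero multiple of \<open>a\<close>
      into \<open>H\<close>, and hence \<open>a\<close> itself after multiplying by the
      \<open>q\<close>-th power of an inverse.\<close>
    have "(t - t') ^ q * a = (s - t' ^ q * a) - (s - t ^ q * a)" by (simp add: fr_diff algebra_simps)
    also have "\<dots> \<in> H" by (rule Hd[OF t(4,3)])
    finally have "inverse (t - t') ^ q * ((t - t') ^ q * a) \<in> H"
      by (rule Hm[OF K_closed(7)[OF K_closed(5)[OF t(1,2)]]])
    moreover have "inverse (t - t') ^ q * ((t - t') ^ q * a) = (inverse (t - t') * (t - t')) ^ q * a"
      by (simp only: power_mult_distrib mult.assoc)
    ultimately show False using Ha \<open>t \<noteq> t'\<close> by simp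
  qed
  define \<pi> where "\<pi> s = (SOME t. t \<in> K \<and> s - t ^ q * a \<in> H)" for s
  have \<pi>: "\<pi> s \<in> K" "s - \<pi> s ^ q * a \<in> H" if "s \<in> K" for s
    using someI_ex[of "\<lambda>t. t \<in> K \<and> s - t ^ q * a \<in> H"] ex[OF that] unfolding \<pi>_def by blast+
  have "\<pi> (s + t) = \<pi> s + \<pi> t" if st: "s \<in> K" "t \<in> K" for s t
  proof (rule uniq)
    have "(s + t) - (\<pi> s + \<pi> t) ^ q * a = (s - \<pi> s ^ q * a) + (t - \<pi> t ^ q * a)"
      by (simp add: fr_add algebra_simps)
    then show "(s + t) - (\<pi> s + \<pi> t) ^ q * a \<in> H"
      using Hp[OF \<pi>(2)[OF st(1)] \<pi>(2)[OF st(2)]] by (simp only:)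
  qed (simp_all add: \<pi> K_closed(4) st)
  moreover have "\<pi> (r ^ q * s) = r * \<pi> s" if rs: "r \<in> K" "s \<in> K" for r s
  proof (rule uniq)
    have "r ^ q * s - (r * \<pi> s) ^ q * a = r ^ q * (s - \<pi> s ^ q * a)"
      by (simp add: power_mult_distrib algebra_simps)
    then show "r ^ q * s - (r * \<pi> s) ^ q * a \<in> H"
      using Hm[OF rs(1) \<pi>(2)[OF rs(2)]] by (simp only:)
  qed (simp_all add: \<pi> K_closed(6,8) rs)
  moreover have "\<pi> a = 1"
    by (rule uniq[of _ _ a]) (simp_all add: \<pi> K_closed(2) a H0)
  ultimately show ?thesis using \<pi> unfolding inv_linear_def by blast
qed

section \<open>Monomial traces on the Laurent ring and on the exchange ring\<close>

context laurent3
begin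

text \<open>A property of a map, written with powers of \<open>x\<close>, \<open>y\<close>,
  \<open>z\<close>, so that the same \<open>\<Phi>\<close> can be recognised as a trace for the
  rotated variables. The map \<open>\<pi>\<close> takes the place of \<open>q\<close>-th roots of
  coefficients, which \<open>K\<close> need not contain.\<close>

definition monomial_trace :: "nat \<Rightarrow> ('f \<Rightarrow> 'f) \<Rightarrow> ('f \<Rightarrow> 'f) \<Rightarrow> bool" where
  "monomial_trace q \<pi> \<Phi> \<longleftrightarrow> (\<forall>k\<in>K. \<forall>a b c. \<Phi> (k * (x powi a * y powi b * z powi c)) =
     (if int q dvd a \<and> int q dvd b \<and> int q dvd c
      then \<pi> k * (x powi (a div int q) * y powi (b div int q) * z powi (c div int q)) else 0))"

lemma monomial_traceD:
  "monomial_trace q \<pi> \<Phi> \<Longrightarrow> k \<in> K \<Longrightarrow> \<Phi> (k * mon (a, b, c)) =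
     (if int q dvd a \<and> int q dvd b \<and> int q dvd c
      then \<pi> k * mon (a div int q, b div int q, c div int q) else 0)"
  unfolding monomial_trace_def mon_def by simp

lemma L_add: "g \<in> L \<Longrightarrow> h \<in> L \<Longrightarrow> g + h \<in> L"
  by (rule Lspan_add)

lemma monomial_trace_exists:
  assumes "prime CHAR('f)" "q = CHAR('f) ^ e" "inv_linear q K \<pi>"
  shows "\<exists>\<Phi>. inv_linear q L \<Phi> \<and> monomial_trace q \<pi> \<Phi>"
proof -
  note \<pi> = inv_linearD[OF assms(3)]
  have q: "q > 0" using assms(1,2) prime_gt_0_nat by simp
  define h where "h = (\<lambda>(a, b, c) k. if int q dvd a \<and> int q dvd b \<and> int q dvd c
    then \<pi> k * mon (a div int q, b div int q, c div int q) else 0)"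
  have "\<And>m k l. k \<in> K \<Longrightarrow> l \<in> K \<Longrightarrow> h m (k + l) = h m k + h m l"
    unfolding h_def by (auto simp: \<pi> distrib_right)
  from additive_extension[of h, OF this] obtain \<Phi>
    where add: "\<And>g g'. g \<in> L \<Longrightarrow> g' \<in> L \<Longrightarrow> \<Phi> (g + g') = \<Phi> g + \<Phi> g'"
      and mon: "\<And>k m. k \<in> K \<Longrightarrow> \<Phi> (k * mon m) = h m k" by blast
  have zero: "\<Phi> 0 = 0" using add[OF Lspan_0 Lspan_0] by (simp only: add_0_right add_cancel_right_right)
  have mon_L: "\<Phi> (k * mon (a, b, c)) \<in> L" if "k \<in> K" for k a b c
    using that by (auto simp: mon h_def \<pi> intro!: LspanI)
  have "\<Phi> s \<in> L" if "s \<in> L" for s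
    using that by (induction rule: Lspan_induct) (auto simp: zero add L_mon mon_L intro!: L_add)
  moreover have "\<Phi> (r ^ q * s) = r * \<Phi> s" if r: "r \<in> L" and s: "s \<in> L" for r s
    using r
  proof (induction rule: Lspan_induct)
    case zero
    have "(0 :: 'f) ^ q = 0" using q by simp
    then show ?case by (simp only: \<open>\<Phi> 0 = 0\<close> mult_zero_left)
  next
    case (step k a b c r)
    have "\<Phi> ((k * mon (a, b, c)) ^ q * s) = k * mon (a, b, c) * \<Phi> s"
      using s
    proof (induction rule: Lspan_induct)
      case zero
      then show ?case by (simp add: \<open>\<Phi> 0 = 0\<close>)
    next
      case (step l a' b' c' s)
      have kq: "k ^ q \<in> K" using K_closed(8) \<open>k \<in> K\<close> .
      have "(k * mon (a, b, c)) ^ q * (l * mon (a', b', c')) =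
          (k ^ q * l) * mon (a * int q + a', b * int q + b', c * int q + c')"
        by (simp add: power_mult_distrib mon_power mult_ac flip: mon_mult)
      then have "\<Phi> ((k * mon (a, b, c)) ^ q * (l * mon (a', b', c'))) =
          h (a * int q + a', b * int q + b', c * int q + c') (k ^ q * l)"
        using mon[OF K_closed(6)[OF kq \<open>l \<in> K\<close>]] by (simp only:)
      \<comment> \<open>Adding \<open>a * q\<close> to an exponent does not change whether
        \<open>q\<close> divides it and raises the quotient by \<open>a\<close>.\<close>
      also have "\<dots> = k * mon (a, b, c) * h (a', b', c') l"
        using q \<pi>(3)[OF \<open>k \<in> K\<close> \<open>l \<in> K\<close>]
        unfolding h_def by (auto simp: mon_mult[symmetric] mult_ac)
      also have "\<dots> = k * mon (a, b, c) * \<Phi> (l * mon (a', b', c'))"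
        using mon step by simp
      finally have "\<Phi> ((k * mon (a, b, c)) ^ q * (l * mon (a', b', c'))) =
        k * mon (a, b, c) * \<Phi> (l * mon (a', b', c'))" .
      moreover have "(k * mon (a, b, c)) ^ q \<in> L" using \<open>k \<in> K\<close> by (intro L_power L_mon)
      ultimately show ?case using step \<open>k \<in> K\<close>
        by (simp only: distrib_left add L_mult L_mon step.IH)
    qed
    moreover have "(k * mon (a, b, c)) ^ q * s \<in> L" "r ^ q * s \<in> L"
      using step s by (auto intro!: L_mult L_power L_mon)
    ultimately show ?case using step
      by (simp only: freshmans_dream'[OF assms(1,2)] distrib_right add)
  qed
  ultimately have "inv_linear q L \<Phi>" using add unfolding inv_linear_def by blast
  moreover have "monomial_trace q \<pi> \<Phi>"
    unfolding monomial_trace_def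
  proof (intro ballI allI)
    fix k a b c assume "k \<in> K"
    then show "\<Phi> (k * (x powi a * y powi b * z powi c)) =
        (if int q dvd a \<and> int q dvd b \<and> int q dvd c
         then \<pi> k * (x powi (a div int q) * y powi (b div int q) * z powi (c div int q)) else 0)"
      using mon[of k "(a, b, c)"] by (simp add: h_def mon_def)
  qed
  ultimately show ?thesis by blast
qed

lemma inv_linear_0: "inv_linear q L \<Phi> \<Longrightarrow> \<Phi> 0 = 0"
  using inv_linearD(2)[of q L \<Phi>, OF _ Lspan_0 Lspan_0] by (simp only: add_0_right add_cancel_right_right)

lemma monomial_trace_Lspan:
  assumes "inv_linear q L \<Phi>" "monomial_trace q \<pi> \<Phi>" "inv_linear q K \<pi>" "q > 0"
    and "g \<in> Lspan {m. fst m = a}"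
  shows "if int q dvd a then \<Phi> g \<in> Lspan {m. fst m = a div int q} else \<Phi> g = 0"
  using assms(5)
proof (induction rule: Lspan_induct)
  case zero
  show ?case using inv_linear_0[OF assms(1)] by simp
next
  case (step k a' b c g)
  have "\<Phi> (k * mon (a', b, c) + g) = \<Phi> (k * mon (a', b, c)) + \<Phi> g"
    using inv_linearD(2)[OF assms(1)] step by (simp add: L_mon Lspan_L)
  moreover have "if int q dvd a then \<Phi> (k * mon (a', b, c)) \<in> Lspan {m. fst m = a div int q}
      else \<Phi> (k * mon (a', b, c)) = 0"
    using step inv_linearD(1)[OF assms(3)] by (auto simp: monomial_traceD[OF assms(2)] intro!: LspanI)
  ultimately show ?case using step.IH by (auto split: if_splits intro: Lspan_add)
qed

lemma P_power_mult_exch: "g \<in> Lspan {m. fst m \<ge> - int n} \<Longrightarrow> P ^ n * g \<in> exch_ring"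
proof (induction rule: Lspan_induct)
  case (step k a b c g)
  then show ?case using exch_gensI[of k a n b c]
    by (simp add: distrib_left mult.commute exch_ring_add exch_ring_gen)
qed simp

text \<open>On a generator of \<open>x\<close>-degree \<open>a = q * n\<close> with
  \<open>n < 0\<close>, the bound \<open>- a \<le> d\<close> makes \<open>P ^ d\<close> contain the
  \<open>q\<close>-th power of \<open>P ^ m\<close>, where \<open>m = - n\<close>. It comes out of
  the trace as \<open>P ^ m\<close>, which is what the new degree \<open>n\<close> calls
  for.\<close>

lemma monomial_trace_exch:
  assumes "inv_linear q L \<Phi>" "monomial_trace q \<pi> \<Phi>" "inv_linear q K \<pi>" "q > 0" "g \<in> exch_ring"
  shows "\<Phi> g \<in> exch_ring"
  using assms(5)
proof (induction rule: exch_ring_induct)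
  case zero
  show ?case using inv_linear_0[OF assms(1)] by simp
next
  case (step k a b c d g)
  note tr = monomial_trace_Lspan[OF assms(1-4)]
  have "\<Phi> (k * mon (a, b, c) * P ^ d) \<in> exch_ring"
  proof (cases "int q dvd a")
    case False
    then show ?thesis using tr[OF exch_gen_Lspan[OF step.hyps(1), of a b c d]] by simp
  next
    case True
    then obtain n where n: "a = int q * n" by blast
    \<comment> \<open>For \<open>n \<ge> 0\<close> this is 0 and no factor \<open>P\<close> has to
      be pulled out, so both signs are treated together.\<close>
    define m where "m = nat (- n)"
    have "int (q * m) \<le> int d" using step.hyps(2) n by (cases "n \<ge> 0") (simp_all add: m_def)
    then have "m * q \<le> d" by (simp only: of_nat_le_iff mult.commute)
    then have "d = m * q + (d - m * q)" by simp
    then have "P ^ d = (P ^ m) ^ q * P ^ (d - m * q)" by (metis power_add power_mult)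
    then have eq: "k * mon (a, b, c) * P ^ d = (P ^ m) ^ q * (k * mon (a, b, c) * P ^ (d - m * q))"
      by simp
    have "\<Phi> (k * mon (a, b, c) * P ^ d) = P ^ m * \<Phi> (k * mon (a, b, c) * P ^ (d - m * q))"
      unfolding eq using inv_linearD(3)[OF assms(1)] step
      by (simp add: Lspan_L[OF exch_gen_Lspan] Lspan_L[OF P_power_Lspan])
    moreover have "\<Phi> (k * mon (a, b, c) * P ^ (d - m * q)) \<in> Lspan {m. fst m = n}"
      using tr[OF exch_gen_Lspan[OF step.hyps(1), of a b c "d - m * q"]] True n assms(4) by simp
    then have "\<Phi> (k * mon (a, b, c) * P ^ (d - m * q)) \<in> Lspan {k. fst k \<ge> - int m}"
      by (rule Lspan_mono) (auto simp: m_def)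
    ultimately show ?thesis using P_power_mult_exch by simp
  qed
  moreover have "\<Phi> (k * mon (a, b, c) * P ^ d + g) = \<Phi> (k * mon (a, b, c) * P ^ d) + \<Phi> g"
    using inv_linearD(2)[OF assms(1)] step by (simp add: exch_ring_L Lspan_L[OF exch_gen_Lspan])
  ultimately show ?case using step.IH exch_ring_add by simp
qed

lemma of_nat_K: "of_nat n \<in> K"
  by (induction n) (auto intro: K_closed)

lemma numeral_K: "numeral n \<in> K"
  using of_nat_K[of "numeral n"] by simp

lemma M_sum_mon: "M = mon (1, -1, -1) + mon (-1, 1, -1) + mon (-1, -1, 1)"
  using nonzero by (simp add: M_def mon_def power_int_minus field_simps power2_eq_square)

text \<open>
  Up to monomials with an exponent \<open>-2\<close>, the element \<open>x y z M\<^sup>3\<close> is the multinomial coefficient \<open>6\<close>.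
\<close>

lemma xyz_M_cubed:
  "x * y * z * M ^ 3 = mon (4, -2, -2) + mon (-2, 4, -2) + mon (-2, -2, 4) +
     3 * (mon (2, 0, -2) + mon (2, -2, 0) + mon (0, 2, -2) + mon (-2, 2, 0) +
       mon (0, -2, 2) + mon (-2, 0, 2)) + 6"
proof -
  let ?u = "mon (1, -1, -1)" and ?v = "mon (-1, 1, -1)" and ?w = "mon (-1, -1, 1)"
    and ?c = "mon (1, 1, 1)"
  have exp: "(u + v + w) ^ 3 = u * u * u + v * v * v + w * w * w +
      3 * (u * u * v + u * u * w + v * v * u + v * v * w + w * w * u + w * w * v) + 6 * (u * v * w)" for u v w :: 'f
    by (simp add: power3_eq_cube algebra_simps)
  have c: "x * y * z = ?c" by (simp add: mon_def)
  show ?thesis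
    unfolding M_sum_mon exp c distrib_left mult.left_commute[of ?c 3] mult.left_commute[of ?c 6]
    by (simp only: mon_mult mult.assoc) (simp add: mon_0 algebra_simps)
qed

text \<open>As \<open>q > 2\<close> does not divide an exponent -2, the trace sees only the constant
  6, and \<open>inverse 6\<close> normalises it.\<close>

lemma monomial_trace_xyz_M_cubed:
  assumes "inv_linear q L \<Phi>" "monomial_trace q \<pi> \<Phi>" "inv_linear q K \<pi>" "\<pi> 1 = 1"
    and "q > 2" "(6 :: 'f) \<noteq> 0"
  shows "\<Phi> (M ^ 3 * inverse 6 * (x * y * z)) = 1"
proof -
  define i :: 'f where "i = inverse 6"
  have i: "i \<in> K" "3 * i \<in> K"
    using K_closed(6)[OF numeral_K K_closed(7)[OF numeral_K]] K_closed(7)[OF numeral_K] by (simp_all only: i_def)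
  have nd: "\<not> int q dvd 2" "\<not> int q dvd - 2" using assms(5) by (auto dest: zdvd_imp_le)
  have z: "\<Phi> (k * mon (a, b, c)) = 0" if "a = -2 \<or> b = -2 \<or> c = -2" "k \<in> K" for k a b c
    using that nd monomial_traceD[OF assms(2)] by auto
  have one: "\<Phi> (1 * mon (0, 0, 0)) = 1 * mon (0, 0, 0)"
    using monomial_traceD[OF assms(2), of 1 0 0 0] assms(4) K_closed by simp
  have "M ^ 3 * inverse 6 * (x * y * z) = i * (x * y * z * M ^ 3)" by (simp add: i_def)
  also have "\<dots> = i * mon (4, -2, -2) + i * mon (-2, 4, -2) + i * mon (-2, -2, 4) +
     (3 * i) * mon (2, 0, -2) + (3 * i) * mon (2, -2, 0) + (3 * i) * mon (0, 2, -2) +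
     (3 * i) * mon (-2, 2, 0) + (3 * i) * mon (0, -2, 2) + (3 * i) * mon (-2, 0, 2) + 1 * mon (0, 0, 0)"
    unfolding xyz_M_cubed using assms(6) by (simp add: i_def mon_0 algebra_simps)
  finally have eq: "M ^ 3 * inverse 6 * (x * y * z) = \<dots>" .
  note add = inv_linearD(2)[OF assms(1)]
  show ?thesis
    unfolding eq using i K_closed(2)
    by (simp add: add L_add L_mon z one del: mult_1) (simp add: mon_0)
qed

lemma inv_linear_sum:
  "inv_linear q L \<Phi> \<Longrightarrow> (\<And>i. i \<in> I \<Longrightarrow> f i \<in> L) \<Longrightarrow> \<Phi> (sum f I) = (\<Sum>i\<in>I. \<Phi> (f i))"
  by (induction I rule: infinite_finite_induct)
    (auto simp: inv_linear_0 inv_linearD(2) Lspan_sum)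

text \<open>For \<open>p\<^sup>e\<close> larger than the spread of the exponents of \<open>g\<close>, one monomial of \<open>g\<close> can be isolated.\<close>

lemma monomial_trace_isolate:
  assumes "prime CHAR('f)" "g \<in> L" "g \<noteq> 0"
  shows "\<exists>e \<pi> \<Phi> m. inv_linear (CHAR('f) ^ e) K \<pi> \<and> inv_linear (CHAR('f) ^ e) L \<Phi> \<and>
    monomial_trace (CHAR('f) ^ e) \<pi> \<Phi> \<and> \<Phi> (mon m * g) = 1"
proof -
  obtain k where k: "rep g k" using rep_exists[OF assms(2)] by blast
  let ?F = "{m. k m \<noteq> 0}"
  have F: "finite ?F" and kK: "\<And>m. k m \<in> K" and g: "g = (\<Sum>m\<in>?F. k m * mon m)"
    using k unfolding rep_def by blast+
  have "?F \<noteq> {}"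
  proof
    assume "?F = {}"
    then have "g = 0" using g by (simp only: sum.empty)
    then show False using assms(3) by simp
  qed
  then obtain m0 where m0: "m0 \<in> ?F" by blast
  obtain a0 b0 c0 where m0_eq: "m0 = (a0, b0, c0)" by (cases m0)
  \<comment> \<open>Dominates the distance of each exponent of \<open>m\<close> from that of
    \<open>m0\<close>. With \<open>e\<close> the maximum and \<open>q > e\<close>, an exponent in
    \<open>g\<close> congruent modulo \<open>q\<close> to that of \<open>m0\<close> equals it, so
    after the shift by \<open>?w\<close> only the term at \<open>m0\<close> survives the
    trace.\<close>
  define size where "size = (\<lambda>(a, b, c). nat \<bar>a - a0\<bar> + nat \<bar>b - b0\<bar> + nat \<bar>c - c0\<bar>)"
  have "finite (size ` ?F)" using F by (rule finite_imageI)
  then have e: "size m \<le> Max (size ` ?F)" if "m \<in> ?F" for m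
    by (rule Max_ge) (rule imageI[OF that])
  define e where "e = Max (size ` ?F)"
  note e = e[folded e_def]
  define q where "q = CHAR('f) ^ e"
  have "CHAR('f) \<ge> Suc (Suc 0)" using prime_ge_2_nat[OF assms(1)] by simp
  then have "e < q" unfolding q_def by (simp add: power_gt_expt)
  have q0: "q > 0" using \<open>e < q\<close> by simp
  \<comment> \<open>The functional is fitted to the coefficient at \<open>m0\<close>, so that the
    surviving term becomes exactly 1.\<close>
  obtain \<pi> where \<pi>: "inv_linear q K \<pi>" "\<pi> (k m0) = 1"
    using inv_linear_functional[OF subfield_K assms(1) q_def kK, of m0] m0 by auto
  obtain \<Phi> where \<Phi>: "inv_linear q L \<Phi>" "monomial_trace q \<pi> \<Phi>"
    using monomial_trace_exists[OF assms(1) q_def \<pi>(1)] by blast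
  let ?w = "mon (- a0, - b0, - c0)"
  have "?w * g = (\<Sum>m\<in>?F. k m * (?w * mon m))"
    unfolding g by (simp add: sum_distrib_left mult.left_commute)
  also have "\<Phi> \<dots> = (\<Sum>m\<in>?F. \<Phi> (k m * (?w * mon m)))"
    by (rule inv_linear_sum[OF \<Phi>(1)]) (intro L_mult L_K kK mon_in_Lspan UNIV_I)
  also have "\<dots> = (\<Sum>m\<in>?F. if m = m0 then 1 else 0)"
  proof (rule sum.cong[OF HOL.refl])
    fix m assume m: "m \<in> ?F"
    obtain a b c where m_eq: "m = (a, b, c)" by (cases m)
    have small: "u = u0" if "int q dvd - u0 + u" "nat \<bar>u - u0\<bar> \<le> e" for u u0 :: int
      using that \<open>e < q\<close> zdvd_imp_le[of "int q" "\<bar>u - u0\<bar>"] by (cases "u = u0") auto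
    have "nat \<bar>a - a0\<bar> \<le> e" "nat \<bar>b - b0\<bar> \<le> e" "nat \<bar>c - c0\<bar> \<le> e"
      using e[OF m] by (auto simp: size_def m_eq)
    then show "\<Phi> (k m * (?w * mon m)) = (if m = m0 then 1 else 0)"
      using small[of a0 a] small[of b0 b] small[of c0 c] \<pi>(2)
      by (auto simp: m_eq m0_eq mon_mult mon_0 monomial_traceD[OF \<Phi>(2) kK])
  qed
  also have "\<dots> = 1" using F m0 by simp
  finally have "\<Phi> (?w * g) = 1" .
  with \<pi>(1) \<Phi> show ?thesis
    unfolding q_def by (intro exI[of _ e] exI[of _ \<pi>] exI[of _ \<Phi>] exI[of _ "(- a0, - b0, - c0)"] conjI)
qed

end

section \<open>F-finiteness and F-regularity of subrings of a field\<close>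

lemma ex_frob_root:
  fixes r :: "'f::field"
  assumes "prime CHAR('f)"
  shows "\<exists>y :: 'f alg_closure. y ^ (CHAR('f) ^ e) = to_ac r"
  by (rule nth_root_exists) (use assms prime_gt_0_nat in simp)

lemma frob_root_power:
  fixes r :: "'f::field"
  assumes "prime CHAR('f)"
  shows "frob_root e r ^ (CHAR('f) ^ e) = to_ac r"
  unfolding frob_root_def
proof (rule theI')
  obtain y :: "'f alg_closure" where y: "y ^ (CHAR('f) ^ e) = to_ac r"
    using ex_frob_root[OF assms] by blast
  show "\<exists>!y. y ^ (CHAR('f) ^ e) = to_ac r"
    by (rule ex1I[of _ y]) (use assms y in \<open>auto intro: frobenius_inj[where e = e]\<close>)
qed

text \<open>A root \<open>y\<close> is sent through its power \<open>y ^ q\<close>, which lies in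
  the image of \<open>R\<close>. Frobenius is additive and turns a scalar \<open>r\<close> into
  \<open>r ^ q\<close>, which \<open>\<Phi>\<close> releases as \<open>r\<close>.\<close>

lemma strongly_F_regularI:
  fixes R :: "'f::field set"
  assumes "prime CHAR('f)" "subdomain R ring_of_type_algebra" "F_finite R"
    and R_closed: "\<And>a b. a \<in> R \<Longrightarrow> b \<in> R \<Longrightarrow> a + b \<in> R" "\<And>a b. a \<in> R \<Longrightarrow> b \<in> R \<Longrightarrow> a * b \<in> R"
      "\<And>a n. a \<in> R \<Longrightarrow> a ^ n \<in> R"
    and "\<And>a. a \<in> R \<Longrightarrow> a \<noteq> 0 \<Longrightarrow> \<exists>e \<Phi>. inv_linear (CHAR('f) ^ e) R \<Phi> \<and> \<Phi> a = 1"
  shows "strongly_F_regular R"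
  unfolding strongly_F_regular_def
proof (intro conjI ballI impI)
  fix a assume "a \<in> R" "a \<noteq> 0"
  then obtain e \<Phi> where \<Phi>: "inv_linear (CHAR('f) ^ e) R \<Phi>" "\<Phi> a = 1"
    using assms(7) by blast
  define q where "q = CHAR('f) ^ e"
  note \<Phi>D = inv_linearD[OF \<Phi>(1), folded q_def]
  define \<psi> where "\<psi> y = \<Phi> (of_ac (y ^ q))" for y :: "'f alg_closure"
  have \<psi>: "\<psi> y = \<Phi> r" if "y ^ q = to_ac r" for y r
    using that by (simp add: \<psi>_def)
  have root: "\<exists>r\<in>R. y ^ q = to_ac r" if "y \<in> frob_roots e R" for y
    using that by (auto simp: frob_roots_def q_def)
  have "\<psi> y \<in> R" if y: "y \<in> frob_roots e R" for y
    using root[OF y] \<psi> \<Phi>D by auto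
  moreover have "\<psi> (y + z) = \<psi> y + \<psi> z" if yz: "y \<in> frob_roots e R" "z \<in> frob_roots e R" for y z
  proof -
    obtain r s where rs: "r \<in> R" "s \<in> R" "y ^ q = to_ac r" "z ^ q = to_ac s"
      using root yz by blast
    have "(y + z) ^ q = y ^ q + z ^ q"
      by (rule freshmans_dream'[where n = e]) (use assms(1) in \<open>simp_all add: q_def\<close>)
    then have "(y + z) ^ q = to_ac (r + s)" using rs by simp
    then show ?thesis using \<psi> rs \<Phi>D by metis
  qed
  moreover have "\<psi> (to_ac r * y) = r * \<psi> y" if ry: "r \<in> R" "y \<in> frob_roots e R" for r y
  proof -
    obtain s where s: "s \<in> R" "y ^ q = to_ac s" using root ry by blast
    then have "(to_ac r * y) ^ q = to_ac (r ^ q * s)" by (simp add: power_mult_distrib)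
    then show ?thesis using \<psi> s ry \<Phi>D by metis
  qed
  ultimately have "\<psi> \<in> frob_hom e R" by (simp add: frob_hom_def)
  moreover have "\<psi> (frob_root e a) = 1"
    using \<psi>[of "frob_root e a" a] frob_root_power[OF assms(1), of e a] \<Phi>(2) by (simp add: q_def)
  ultimately show "\<exists>e. \<exists>\<psi>\<in>frob_hom e R. \<psi> (frob_root e a) = 1" by blast
qed (use assms prime_gt_0_nat in auto)

lemma addspan_linear_combination:
  fixes B :: "'f::field alg_closure set"
  assumes "finite B" "y \<in> addspan {to_ac a * b | a b. a \<in> R \<and> b \<in> B}"
    and "0 \<in> R" "\<And>a b. a \<in> R \<Longrightarrow> b \<in> R \<Longrightarrow> a + b \<in> R"
  shows "\<exists>c. c ` B \<subseteq> R \<and> y = (\<Sum>b\<in>B. to_ac (c b) * b)"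
  using assms(2)
proof (induction rule: addspan.induct)
  case zero
  show ?case by (rule exI[of _ "\<lambda>_. 0"]) (use assms(3) in auto)
next
  case (step s t)
  then obtain a b c where a: "s = to_ac a * b" "a \<in> R" "b \<in> B"
    and c: "c ` B \<subseteq> R" "t = (\<Sum>b\<in>B. to_ac (c b) * b)" by blast
  define c' where "c' = (\<lambda>b'. (if b' = b then a else 0) + c b')"
  have "(\<Sum>b\<in>B. to_ac (c' b) * b) = (\<Sum>b'\<in>B. if b' = b then to_ac a * b else 0) + t"
    unfolding c c'_def by (simp add: distrib_right sum.distrib if_distrib[of to_ac] if_distrib[of "\<lambda>u. u * _"] cong: if_cong)
  also have "\<dots> = s + t" using a assms(1) by simp
  finally show ?case using a c assms(3,4) by (intro exI[of _ c']) (auto simp: c'_def)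
qed

text \<open>With \<open>\<gamma>\<close> a \<open>p\<close>-th root of \<open>g\<close>, a root of a
  sum of terms \<open>r * g ^ n\<close> is the sum of the roots of \<open>r\<close> times
  \<open>\<gamma> ^ n\<close>. Since \<open>\<gamma> ^ p\<close> is the scalar \<open>g\<close>, the
  products of members of \<open>B\<close> with \<open>\<gamma> ^ i\<close>, \<open>i < p\<close>,
  generate.\<close>

lemma F_finite_adjoin:
  fixes S :: "'f::field set"
  assumes "prime CHAR('f)" "F_finite (rgen S)"
  shows "F_finite (rgen (insert g S))"
proof -
  define p where "p = CHAR('f)"
  have p: "p > 0" using assms(1) prime_gt_0_nat by (simp add: p_def)
  have char: "prime CHAR('f alg_closure)" "p = CHAR('f alg_closure) ^ 1" using assms(1) by (simp_all add: p_def)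
  define R where "R = rgen S"
  define A where "A = rgen (insert g S)"
  have RA: "R \<subseteq> A" unfolding R_def A_def by (rule rgen_subset) (auto intro: rgen_incl)
  have gA: "g \<in> A" unfolding A_def by (rule rgen_incl) simp
  have A_closed: "0 \<in> A" "1 \<in> A" "\<And>a b. a \<in> A \<Longrightarrow> b \<in> A \<Longrightarrow> a + b \<in> A" "\<And>a b. a \<in> A \<Longrightarrow> b \<in> A \<Longrightarrow> a * b \<in> A"
    "\<And>a n. a \<in> A \<Longrightarrow> a ^ n \<in> A"
    unfolding A_def by (auto intro: rgen_add rgen_mult rgen_power)
  obtain B where B: "finite B" "B \<subseteq> frob_roots 1 R"
    "\<And>y. y \<in> frob_roots 1 R \<Longrightarrow> \<exists>c. c ` B \<subseteq> R \<and> y = (\<Sum>b\<in>B. to_ac (c b) * b)"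
    using assms(2) unfolding F_finite_def R_def by blast
  obtain \<gamma> :: "'f alg_closure" where \<gamma>: "\<gamma> ^ p = to_ac g"
    using ex_frob_root[OF assms(1), of 1] by (auto simp: p_def)
  define B' where "B' = (\<lambda>(b, i). b * \<gamma> ^ i) ` (B \<times> {..<p})"
  have B'I: "b * \<gamma> ^ i \<in> B'" if "b \<in> B" "i < p" for b i
    using that unfolding B'_def by force
  have fin: "finite B'" using B(1) by (simp add: B'_def)
  define T where "T = addspan {to_ac a * b | a b. a \<in> A \<and> b \<in> B'}"
  have TI: "to_ac a * b \<in> T" if "a \<in> A" "b \<in> B'" for a b
    using that unfolding T_def by (blast intro: addspan_base)
  have T\<gamma>: "\<gamma> * y \<in> T" if "y \<in> T" for y
    using that unfolding T_def
  proof (induction rule: addspan.induct)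
    case (step s t)
    then obtain a b i where s: "s = to_ac a * (b * \<gamma> ^ i)" "a \<in> A" "b \<in> B" "i < p"
      unfolding B'_def by auto
    have "\<gamma> * s \<in> T"
    proof (cases "Suc i < p")
      case True
      then show ?thesis using TI[OF s(2) B'I[OF s(3) True]] by (simp add: s(1) mult_ac)
    next
      \<comment> \<open>The power wraps around: \<open>\<gamma> ^ p\<close> becomes the scalar
        \<open>g\<close> and the exponent returns to 0.\<close>
      case False
      then have "Suc i = p" using s(4) by simp
      then have "\<gamma> * \<gamma> ^ i = to_ac g" using \<gamma> by (metis power_Suc)
      then have "\<gamma> * s = to_ac (a * g) * (b * \<gamma> ^ 0)" by (simp add: s(1) mult_ac)
      then show ?thesis using TI[OF A_closed(4)[OF s(2) gA] B'I[OF s(3) p]] by simp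
    qed
    then show ?case using step.IH unfolding T_def by (simp add: distrib_left addspan_add)
  qed simp
  have T\<gamma>n: "\<gamma> ^ n * y \<in> T" if "y \<in> T" for y n
    using that by (induction n) (simp_all add: T\<gamma> mult.assoc)
  have TR: "y \<in> T" if y: "y \<in> frob_roots 1 R" for y
  proof -
    obtain c where c: "c ` B \<subseteq> R" "y = (\<Sum>b\<in>B. to_ac (c b) * b)" using B(3)[OF y] by blast
    have "to_ac (c b) * b \<in> T" if b: "b \<in> B" for b
      using TI[of "c b" "b * \<gamma> ^ 0"] B'I[OF b p] c(1) b RA by auto
    then show ?thesis unfolding c(2) T_def by (intro addspan_sum) simp
  qed
  have ex: "\<exists>y\<in>T. y ^ p = to_ac a" if a: "a \<in> A" for a
  proof -
    have "A \<subseteq> addspan {r * g ^ n | r n. r \<in> R}"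
      unfolding A_def
    proof (rule rgen_subset_addspan)
      have I: "r * g ^ n \<in> {r * g ^ n | r n. r \<in> R}" if "r \<in> R" for r n using that by blast
      show "1 \<in> {r * g ^ n | r n. r \<in> R}" using I[of 1 0] by (simp add: R_def)
      show "- s \<in> {r * g ^ n | r n. r \<in> R}" if s: "s \<in> {r * g ^ n | r n. r \<in> R}" for s
      proof -
        obtain r n where "s = r * g ^ n" "r \<in> R" using s by blast
        then show ?thesis using I[of "- r" n] rgen_uminus[of r S] by (simp add: R_def)
      qed
      show "s * t \<in> {r * g ^ n | r n. r \<in> R}"
        if st: "s \<in> {r * g ^ n | r n. r \<in> R}" "t \<in> {r * g ^ n | r n. r \<in> R}" for s t
      proof -
        obtain r n r' n' where st: "s = r * g ^ n" "r \<in> R" "t = r' * g ^ n'" "r' \<in> R" using st by blast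
        then have eq: "s * t = (r * r') * g ^ (n + n')" by (simp add: power_add)
        have "r * r' \<in> R" using st by (simp add: R_def rgen_mult)
        from I[OF this] show ?thesis unfolding eq .
      qed
      show "insert g S \<subseteq> {r * g ^ n | r n. r \<in> R}"
      proof
        fix s assume "s \<in> insert g S"
        then show "s \<in> {r * g ^ n | r n. r \<in> R}"
          using I[of 1 1] I[of s 0] rgen_incl[of s S] by (auto simp: R_def)
      qed
    qed
    with a have "a \<in> addspan {r * g ^ n | r n. r \<in> R}" by blast
    then show ?thesis
    proof (induction rule: addspan.induct)
      case zero
      show ?case by (rule bexI[of _ 0]) (use p in \<open>simp_all add: T_def zero_power\<close>)
    next
      case (step s t)
      then obtain r n y where s: "s = r * g ^ n" "r \<in> R" and y: "y \<in> T" "y ^ p = to_ac t" by blast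
      obtain \<rho> :: "'f alg_closure" where \<rho>: "\<rho> ^ p = to_ac r"
        using ex_frob_root[OF assms(1), of 1] by (auto simp: p_def)
      then have "\<rho> \<in> frob_roots 1 R" using s(2) by (simp add: frob_roots_def p_def)
      then have "\<gamma> ^ n * \<rho> \<in> T" by (intro T\<gamma>n TR)
      then have "\<gamma> ^ n * \<rho> + y \<in> T" using y(1) unfolding T_def by (rule addspan_add)
      moreover have "(\<gamma> ^ n) ^ p = to_ac (g ^ n)"
        by (simp only: \<gamma>[symmetric] to_ac_power power_mult[symmetric] mult.commute)
      then have "(\<gamma> ^ n * \<rho> + y) ^ p = to_ac (s + t)"
        unfolding freshmans_dream'[OF char] by (simp add: power_mult_distrib \<rho> y s mult.commute)
      ultimately show ?case by blast
    qed
  qed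
  have "B' \<subseteq> frob_roots 1 A"
  proof
    fix y assume "y \<in> B'"
    then obtain b i where y: "y = b * \<gamma> ^ i" "b \<in> B" unfolding B'_def by auto
    then obtain r where r: "r \<in> R" "b ^ p = to_ac r" using B(2) by (auto simp: frob_roots_def p_def)
    have "(\<gamma> ^ i) ^ p = to_ac (g ^ i)"
      by (simp only: \<gamma>[symmetric] to_ac_power power_mult[symmetric] mult.commute)
    then have "y ^ p = to_ac (r * g ^ i)" by (simp add: y r power_mult_distrib)
    moreover have "r * g ^ i \<in> A" using r RA gA A_closed by blast
    ultimately have "y ^ p \<in> to_ac ` A" by (simp only: imageI)
    then show "y \<in> frob_roots 1 A" by (simp add: frob_roots_def p_def)
  qed
  moreover have "\<exists>c. c ` B' \<subseteq> A \<and> y = (\<Sum>b\<in>B'. to_ac (c b) * b)" if y: "y \<in> frob_roots 1 A" for y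
  proof -
    obtain a where a: "a \<in> A" "y ^ p = to_ac a" using y by (auto simp: frob_roots_def p_def)
    obtain y' where "y' \<in> T" "y' ^ p = to_ac a" using ex[OF a(1)] by blast
    \<comment> \<open>Roots of order \<open>p\<close> are unique, so the root found in
      \<open>T\<close> is the given one.\<close>
    moreover from this have "y = y'" using a frobenius_inj[OF char] by simp
    ultimately show ?thesis
      using addspan_linear_combination[OF fin _ A_closed(1,3)] unfolding T_def by blast
  qed
  ultimately show ?thesis unfolding F_finite_def A_def[symmetric] using fin by blast
qed

lemma F_finite_rgen:
  fixes K :: "'f::field set"
  assumes "prime CHAR('f)" "subfield K ring_of_type_algebra" "F_finite K" "finite G"
  shows "F_finite (rgen (K \<union> G))"
  using assms(4)
proof (induction G rule: finite_induct)
  case empty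
  have "rgen K \<subseteq> K"
  proof
    fix a assume "a \<in> rgen K"
    then show "a \<in> K" by (induction rule: rgen_induct) (auto intro: subfield_closed[OF assms(2)])
  qed
  then have "rgen K = K" by (auto intro: rgen_incl)
  then show ?case using assms(3) by simp
next
  case (insert g G)
  then show ?case using F_finite_adjoin[OF assms(1)] by simp
qed

section \<open>The Markov seed and its mutations\<close>

text \<open>A Laurent relation becomes a polynomial relation on multiplying by a high power of the
  product of the variables, and distinct Laurent monomials stay distinct under this shift.\<close>

lemma laurent3_of_alg_independent:
  fixes w :: "nat \<Rightarrow> 'f::field"
  assumes K: "subfield K ring_of_type_algebra" and ind: "alg_independent K {1..3} w"
  shows "laurent3 K (w 1) (w 2) (w 3)"
proof (rule laurent3.intro)
  show "subfield K ring_of_type_algebra" by fact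
  note K_closed = subfield_closed[OF K]
  have nz: "w i \<noteq> 0" if i: "i \<in> {1..3}" for i
  proof
    assume "w i = 0"
    \<comment> \<open>A zero variable would make the polynomial consisting of that variable alone a
      relation.\<close>
    define Q :: "(nat \<Rightarrow>\<^sub>0 nat) \<Rightarrow>\<^sub>0 'f" where "Q = Poly_Mapping.single (Poly_Mapping.single i 1) 1"
    have "Q = 0"
      by (rule ind[unfolded alg_independent_def, rule_format])
        (use i K_closed \<open>w i = 0\<close> in \<open>auto simp: Q_def lookup_single when_def\<close>)
    then have "poly_mapping.lookup Q (Poly_Mapping.single i 1) = 0" by simp
    then show False by (simp add: Q_def)
  qed
  then show nonzero: "w 1 \<noteq> 0" "w 2 \<noteq> 0" "w 3 \<noteq> 0" by auto
  fix F and k :: "int \<times> int \<times> int \<Rightarrow> 'f" and m0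
  assume F: "finite F" and k: "\<And>m. m \<in> F \<Longrightarrow> k m \<in> K" and m0: "m0 \<in> F"
    and sum0: "(\<Sum>(a, b, c)\<in>F. k (a, b, c) * (w 1 powi a * w 2 powi b * w 3 powi c)) = 0"
  define size where "size = (\<lambda>(a, b, c). \<bar>a\<bar> + \<bar>b\<bar> + \<bar>c\<bar> :: int)"
  have "finite (size ` F)" using F by (rule finite_imageI)
  then have bound: "size m \<le> Max (size ` F)" if "m \<in> F" for m
    by (rule Max_ge) (rule imageI[OF that])
  define N where "N = Max (size ` F)"
  have pos: "0 \<le> a + N" "0 \<le> b + N" "0 \<le> c + N" if "(a, b, c) \<in> F" for a b c
    using bound[OF that] by (auto simp: size_def N_def)
  define em :: "int \<times> int \<times> int \<Rightarrow> nat \<Rightarrow>\<^sub>0 nat" where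
    "em = (\<lambda>(a, b, c). Poly_Mapping.single 1 (nat (a + N)) + Poly_Mapping.single 2 (nat (b + N)) +
      Poly_Mapping.single 3 (nat (c + N)))"
  have look: "poly_mapping.lookup (em (a, b, c)) 1 = nat (a + N)"
    "poly_mapping.lookup (em (a, b, c)) 2 = nat (b + N)"
    "poly_mapping.lookup (em (a, b, c)) 3 = nat (c + N)"
    "i \<notin> {1, 2, 3} \<Longrightarrow> poly_mapping.lookup (em (a, b, c)) i = 0" for a b c i
    by (auto simp: em_def lookup_add lookup_single when_def)
  have inj: "inj_on em F"
  proof (rule inj_onI)
    fix m m' assume m: "m \<in> F" "m' \<in> F" "em m = em m'"
    obtain a b c where 1: "m = (a, b, c)" by (cases m)
    obtain a' b' c' where 2: "m' = (a', b', c')" by (cases m')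
    have "nat (a + N) = nat (a' + N)" "nat (b + N) = nat (b' + N)" "nat (c + N) = nat (c' + N)"
      using m(3) look(1-3)[of a b c] look(1-3)[of a' b' c'] by (simp_all add: 1 2)
    then show "m = m'" using pos[of a b c] pos[of a' b' c'] m(1,2)
      by (simp add: 1 2 eq_nat_nat_iff)
  qed
  have keys: "Poly_Mapping.keys (em m) \<subseteq> {1, 2, 3}" for m
  proof
    fix i assume i: "i \<in> Poly_Mapping.keys (em m)"
    obtain a b c where "m = (a, b, c)" by (cases m)
    then have "poly_mapping.lookup (em (a, b, c)) i \<noteq> 0" using i by (simp add: in_keys_iff)
    then show "i \<in> {1, 2, 3}" by (rule contrapos_np) (rule look(4))
  qed
  define Q :: "(nat \<Rightarrow>\<^sub>0 nat) \<Rightarrow>\<^sub>0 'f" where "Q = (\<Sum>m\<in>F. Poly_Mapping.single (em m) (k m))"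
  have Q: "poly_mapping.lookup Q u = (\<Sum>m\<in>F. if em m = u then k m else 0)" for u
    unfolding Q_def by (simp add: lookup_sum lookup_single when_def)
  have Q_em: "poly_mapping.lookup Q (em m) = k m" if m: "m \<in> F" for m
  proof -
    have "poly_mapping.lookup Q (em m) = (\<Sum>m'\<in>F. if m' = m then k m' else 0)"
      unfolding Q by (rule sum.cong) (use inj m in \<open>auto simp: inj_on_eq_iff\<close>)
    then show ?thesis using F m by simp
  qed
  have Q_0: "poly_mapping.lookup Q u = 0" if "u \<notin> em ` F" for u
    unfolding Q by (rule sum.neutral) (use that in auto)
  have "Q = 0"
  proof (rule ind[unfolded alg_independent_def, rule_format])
    show "poly_mapping.lookup Q u \<in> K" for u
      using Q_em Q_0 k K_closed(1) by (cases "u \<in> em ` F") auto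
    have Qk: "Poly_Mapping.keys Q \<subseteq> em ` F" using Q_0 by (auto simp: in_keys_iff)
    then show "Poly_Mapping.keys u \<subseteq> {1..3}" if "u \<in> Poly_Mapping.keys Q" for u
      using keys that by fastforce
    let ?ev = "\<lambda>u. \<Prod>i\<in>Poly_Mapping.keys u. w i ^ poly_mapping.lookup u i"
    have ev: "?ev (em (a, b, c)) = (w 1 * w 2 * w 3) powi N * (w 1 powi a * w 2 powi b * w 3 powi c)"
      if m: "(a, b, c) \<in> F" for a b c
    proof -
      have "?ev (em (a, b, c)) = (\<Prod>i\<in>{1, 2, 3}. w i ^ poly_mapping.lookup (em (a, b, c)) i)"
        by (rule prod.mono_neutral_left) (use keys in \<open>auto simp: in_keys_iff\<close>)
      also have "\<dots> = w 1 ^ nat (a + N) * (w 2 ^ nat (b + N) * w 3 ^ nat (c + N))"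
        using look(1-3)[of a b c] by simp
      also have "\<dots> = w 1 powi (a + N) * (w 2 powi (b + N) * w 3 powi (c + N))"
        using pos[OF m] by (simp add: power_int_nonneg_exp)
      finally show ?thesis using nonzero by (simp add: power_int_add power_int_mult_distrib mult_ac)
    qed
    have "(\<Sum>u\<in>Poly_Mapping.keys Q. poly_mapping.lookup Q u * ?ev u) =
        (\<Sum>u\<in>em ` F. poly_mapping.lookup Q u * ?ev u)"
      by (rule sum.mono_neutral_left) (use F Qk in \<open>auto simp: in_keys_iff\<close>)
    also have "\<dots> = (\<Sum>m\<in>F. k m * ?ev (em m))"
      by (subst sum.reindex[OF inj]) (simp add: Q_em)
    also have "\<dots> = (\<Sum>m\<in>F. (w 1 * w 2 * w 3) powi N *
        (case m of (a, b, c) \<Rightarrow> k (a, b, c) * (w 1 powi a * w 2 powi b * w 3 powi c)))"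
      by (rule sum.cong) (auto simp: ev)
    also have "\<dots> = 0" using sum0 by (simp flip: sum_distrib_left)
    finally show "(\<Sum>u\<in>Poly_Mapping.keys Q. poly_mapping.lookup Q u * ?ev u) = 0" .
  qed
  then show "k m0 = 0" using Q_em[OF m0] by simp
qed

text \<open>Permuting the exponents carries relations to relations. Whatever is proved for the
  distinguished first variable thereby becomes available for the second and the third.\<close>

lemma laurent3_rotate:
  assumes "laurent3 K x y z"
  shows "laurent3 K y z x"
proof -
  interpret laurent3 K x y z by fact
  show ?thesis
  proof (rule laurent3.intro)
    show "subfield K ring_of_type_algebra" "y \<noteq> 0" "z \<noteq> 0" "x \<noteq> 0"
      by (fact subfield_K nonzero)+
    fix F and k :: "int \<times> int \<times> int \<Rightarrow> 'a" and m
    assume F: "finite F" and k: "\<And>m. m \<in> F \<Longrightarrow> k m \<in> K" and m: "m \<in> F"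
      and sum0: "(\<Sum>(a, b, c)\<in>F. k (a, b, c) * (y powi a * z powi b * x powi c)) = 0"
    let ?r = "\<lambda>(a, b, c). (c, a, b)" and ?s = "\<lambda>(a, b, c). (b, c, a)"
    have inj: "inj_on ?r F" by (auto simp: inj_on_def)
    have "(\<Sum>m\<in>?r ` F. k (?s m) * mon m) = (\<Sum>m\<in>F. k (?s (?r m)) * mon (?r m))"
      by (subst sum.reindex[OF inj]) simp
    also have "\<dots> = (\<Sum>(a, b, c)\<in>F. k (a, b, c) * (y powi a * z powi b * x powi c))"
      by (rule sum.cong) (auto simp: mon_def mult_ac)
    finally have "(\<Sum>m\<in>?r ` F. k (?s m) * mon m) = 0" using sum0 by simp
    then have "k (?s (?r m)) = 0"
      by (rule indep_mon[rotated 2]) (use F k m in auto)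
    then show "k m = 0" by (cases m) simp
  qed
qed

section \<open>Mutation and rotation of the variables\<close>

context laurent3
begin

text \<open>A monomial in \<open>P * inverse x\<close>, \<open>y\<close>, \<open>z\<close> has
  \<open>x\<close>-degree opposite to its first exponent, so a relation splits by that exponent once
  denominators \<open>P\<close> are cleared. In each piece the power of \<open>P\<close> is a common
  factor, and cancelling it leaves a relation among the old monomials.\<close>

lemma laurent3_mutate: "laurent3 K (P * inverse x) y z"
proof (rule laurent3.intro)
  show "subfield K ring_of_type_algebra" "y \<noteq> 0" "z \<noteq> 0" by (fact subfield_K nonzero)+
  show "P * inverse x \<noteq> 0" using P_nonzero nonzero by simp
  fix F and k :: "int \<times> int \<times> int \<Rightarrow> 'f" and m0
  assume F: "finite F" and k: "\<And>m. m \<in> F \<Longrightarrow> k m \<in> K" and m0: "m0 \<in> F"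
    and sum0: "(\<Sum>(a, b, c)\<in>F. k (a, b, c) * ((P * inverse x) powi a * y powi b * z powi c)) = 0"
  define N where "N = Max ((\<lambda>m. \<bar>fst m\<bar>) ` F)"
  have "\<bar>fst m\<bar> \<le> N" if "m \<in> F" for m
    unfolding N_def using F by (intro Max_ge finite_imageI imageI that)
  then have N: "0 \<le> N + a" if "(a, b, c) \<in> F" for a b c using that by fastforce
  let ?r = "\<lambda>(a, b, c). (- a, b, c)"
  define F0 where "F0 = {m \<in> F. fst m = fst m0}"
  have split: "k m * ((P * inverse x) powi fst m * y powi fst (snd m) * z powi snd (snd m)) * P powi N =
      k m * mon (?r m) * P ^ nat (N + fst m)" if m: "m \<in> F" for m
  proof -
    obtain a b c where abc: "m = (a, b, c)" by (cases m)
    have "P ^ nat (N + a) = P powi N * P powi a"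
      using N[of a b c] m P_nonzero by (simp add: abc power_int_nonneg_exp flip: power_int_add)
    then show ?thesis by (simp add: abc mon_def power_int_mult_distrib power_int_inverse power_int_minus)
  qed
  have E: "k m * mon (?r m) * P ^ n \<in> Lspan {u. fst u = - fst m}" if "m \<in> F" for m n
    using exch_gen_Lspan[OF k[OF that], of "- fst m" "fst (snd m)" "snd (snd m)" n] by (simp add: case_prod_unfold)
  have "(\<Sum>m\<in>F. k m * mon (?r m) * P ^ nat (N + fst m)) =
      (\<Sum>m\<in>F. k m * ((P * inverse x) powi fst m * y powi fst (snd m) * z powi snd (snd m))) * P powi N"
    unfolding sum_distrib_right by (rule sum.cong) (simp_all only: split)
  also have "\<dots> = 0" using sum0 by (simp add: case_prod_unfold)
  finally have "0 = proj {u. fst u = - fst m0} (\<Sum>m\<in>F. k m * mon (?r m) * P ^ nat (N + fst m))"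
    by simp
  also have "\<dots> = (\<Sum>m\<in>F. proj {u. fst u = - fst m0} (k m * mon (?r m) * P ^ nat (N + fst m)))"
    by (rule proj_sum) (rule Lspan_L[OF E])
  also have "\<dots> = (\<Sum>m\<in>F. if fst m = fst m0 then k m * mon (?r m) * P ^ nat (N + fst m0) else 0)"
  proof (rule sum.cong)
    fix m assume m: "m \<in> F"
    show "proj {u. fst u = - fst m0} (k m * mon (?r m) * P ^ nat (N + fst m)) =
        (if fst m = fst m0 then k m * mon (?r m) * P ^ nat (N + fst m0) else 0)"
    proof (cases "fst m = fst m0")
      case True
      then show ?thesis using proj_same[OF E[OF m, of "nat (N + fst m)"]] by simp
    next
      case False
      then have "proj {u. fst u = - fst m0} (k m * mon (?r m) * P ^ nat (N + fst m)) = 0"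
        by (intro proj_disjoint[OF E[OF m]]) auto
      then show ?thesis using False by simp
    qed
  qed simp
  also have "\<dots> = (\<Sum>m\<in>F0. k m * mon (?r m)) * P ^ nat (N + fst m0)"
    unfolding F0_def sum_distrib_right by (simp only: sum.inter_filter[OF F])
  finally have "(\<Sum>m\<in>F0. k m * mon (?r m)) = 0" using P_nonzero by simp
  moreover have inj: "inj_on ?r F0" by (auto simp: inj_on_def)
  have "(\<Sum>m\<in>?r ` F0. k (?r m) * mon m) = (\<Sum>m\<in>F0. k m * mon (?r m))"
    by (subst sum.reindex[OF inj]) (auto intro!: sum.cong)
  ultimately have "(\<Sum>m\<in>?r ` F0. k (?r m) * mon m) = 0" by simp
  then have "k (?r (?r m0)) = 0"
    by (rule indep_mon[rotated 2]) (use F k m0 in \<open>auto simp: F0_def\<close>)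
  then show "k m0 = 0" by (cases m0) simp
qed

lemma exchange_relation: "P * inverse x = M * y * z - x"
  using nonzero M_rel by (simp add: P_def field_simps power2_eq_square)

text \<open>\<open>x\<close> and \<open>P * inverse x\<close> are the two roots of
  \<open>t^2 - M * y * z * t + P\<close>, with sum \<open>M * y * z\<close> and product
  \<open>P\<close>; the relation defining \<open>M\<close> says just that \<open>x\<close> is a
  root.\<close>

lemma M_mutate: "laurent3.M (P * inverse x) y z = M"
proof -
  interpret X': laurent3 K "P * inverse x" y z by (rule laurent3_mutate)
  have "x * (P * inverse x) = y ^ 2 + z ^ 2" using nonzero by (simp add: P_def)
  then have "X'.M * (P * inverse x) * y * z = (P * inverse x) * (P * inverse x + x)"
    unfolding X'.M_rel by (simp add: algebra_simps power2_eq_square)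
  also have "P * inverse x + x = M * y * z" by (simp add: exchange_relation)
  finally show ?thesis using X'.nonzero by simp
qed

lemma A_mutate: "laurent3.A K (P * inverse x) y z = A"
proof -
  interpret X': laurent3 K "P * inverse x" y z by (rule laurent3_mutate)
  have "P * inverse x \<in> A" unfolding exchange_relation by (intro A_diff A_mult A_gens)
  moreover have "x = M * y * z - P * inverse x" by (simp add: exchange_relation)
  then have "x \<in> X'.A" using X'.A_diff[OF X'.A_mult[OF X'.A_mult]] X'.A_gens by (metis M_mutate)
  ultimately show ?thesis
    using A_gens X'.A_gens M_mutate unfolding A_def X'.A_def
    by (intro equalityI rgen_subset) auto
qed

lemma M_rotate: "laurent3.M y z x = M"
proof -
  interpret X': laurent3 K y z x by (rule laurent3_rotate) (rule laurent3_axioms)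
  show ?thesis unfolding X'.M_def M_def by (simp add: ac_simps)
qed

lemma A_rotate: "laurent3.A K y z x = A"
proof -
  interpret X': laurent3 K y z x by (rule laurent3_rotate) (rule laurent3_axioms)
  show ?thesis unfolding X'.A_def A_def M_rotate by (simp add: insert_commute)
qed

lemma L_rotate: "laurent3.Lspan K y z x UNIV = L"
proof -
  interpret X': laurent3 K y z x by (rule laurent3_rotate) (rule laurent3_axioms)
  show ?thesis unfolding X'.L_eq_rgen L_eq_rgen by (simp add: insert_commute)
qed

lemma monomial_trace_rotate: "monomial_trace q \<pi> \<Phi> \<Longrightarrow> laurent3.monomial_trace K y z x q \<pi> \<Phi>"
proof -
  interpret X': laurent3 K y z x by (rule laurent3_rotate) (rule laurent3_axioms)
  assume tr: "monomial_trace q \<pi> \<Phi>"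
  show ?thesis
    unfolding X'.monomial_trace_def
  proof (intro ballI allI)
    fix k a b c assume "k \<in> K"
    then have "\<Phi> (k * (x powi c * y powi a * z powi b)) =
        (if int q dvd c \<and> int q dvd a \<and> int q dvd b
         then \<pi> k * (x powi (c div int q) * y powi (a div int q) * z powi (b div int q)) else 0)"
      using tr unfolding monomial_trace_def by blast
    then show "\<Phi> (k * (y powi a * z powi b * x powi c)) =
        (if int q dvd a \<and> int q dvd b \<and> int q dvd c
         then \<pi> k * (y powi (a div int q) * z powi (b div int q) * x powi (c div int q)) else 0)"
      by (simp add: ac_simps)
  qed
qed

end

section \<open>Seeds reachable from the Markov seed\<close>

declare One_nat_def [simp del]

lemma atLeastAtMost_1_3: "{1..3::nat} = {1, 2, 3}"
  by auto

text \<open>The arrows at \<open>l\<close> are turned around, and opposite \<open>l\<close> the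
  \<open>2 * 2 = 4\<close> new composites cancel the 2 old arrows and leave 2 in the other
  direction. So every mutation reverses the whole quiver.\<close>

lemma mutate_markov_arrows:
  assumes "l \<in> {1, 2, 3}"
  shows "cancel_2cycles (reverse_at l (add_composites l markov_arrows)) = (\<lambda>i j. markov_arrows j i)"
    and "cancel_2cycles (reverse_at l (add_composites l (\<lambda>i j. markov_arrows j i))) = markov_arrows"
  using assms
  by (auto simp: fun_eq_iff cancel_2cycles_def reverse_at_def add_composites_def markov_arrows_def)

definition markov_invariant :: "'f::field set \<Rightarrow> 'f set \<Rightarrow> 'f seed \<Rightarrow> bool" where
  "markov_invariant K A T \<longleftrightarrow> nverts T = 3 \<and> frozen T = {} \<and>
     (arrows T = markov_arrows \<or> arrows T = (\<lambda>i j. markov_arrows j i)) \<and>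
     laurent3 K (cluster T 1) (cluster T 2) (cluster T 3) \<and>
     laurent3.A K (cluster T 1) (cluster T 2) (cluster T 3) = A"

text \<open>Reversing the quiver only swaps the two summands of the exchange polynomial, so one
  formula serves both orientations.\<close>

lemma cluster_mutate_markov:
  assumes "nverts T = 3" "arrows T = markov_arrows \<or> arrows T = (\<lambda>i j. markov_arrows j i)"
  shows "cluster (mutate 1 T) = (cluster T)(1 := (cluster T 2 ^ 2 + cluster T 3 ^ 2) * inverse (cluster T 1))"
    and "cluster (mutate 2 T) = (cluster T)(2 := (cluster T 3 ^ 2 + cluster T 1 ^ 2) * inverse (cluster T 2))"
    and "cluster (mutate 3 T) = (cluster T)(3 := (cluster T 1 ^ 2 + cluster T 2 ^ 2) * inverse (cluster T 3))"
  using assms(2)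
  by (auto simp: mutate_def vertices_def assms(1) atLeastAtMost_1_3 markov_arrows_def add.commute)

lemma markov_invariant_mutate:
  assumes T: "markov_invariant K A T" and l: "l \<in> {1, 2, 3}"
  shows "markov_invariant K A (mutate l T)"
proof -
  let ?x = "cluster T 1" and ?y = "cluster T 2" and ?z = "cluster T 3"
  have inv: "nverts T = 3" "frozen T = {}" "arrows T = markov_arrows \<or> arrows T = (\<lambda>i j. markov_arrows j i)"
    "laurent3 K ?x ?y ?z" "laurent3.A K ?x ?y ?z = A"
    using T by (simp_all add: markov_invariant_def)
  interpret X: laurent3 K ?x ?y ?z by fact
  interpret Y: laurent3 K ?y ?z ?x by (rule laurent3_rotate) fact
  interpret Z: laurent3 K ?z ?x ?y by (rule laurent3_rotate) (rule Y.laurent3_axioms)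
  note cl = cluster_mutate_markov[OF inv(1,3)]
  have "nverts (mutate l T) = 3" "frozen (mutate l T) = {}"
    using inv by (simp_all add: mutate_def)
  moreover have "arrows (mutate l T) = markov_arrows \<or> arrows (mutate l T) = (\<lambda>i j. markov_arrows j i)"
    using inv(3) mutate_markov_arrows[OF l] by (auto simp: mutate_def)
  moreover have "laurent3 K (cluster (mutate l T) 1) (cluster (mutate l T) 2) (cluster (mutate l T) 3) \<and>
      laurent3.A K (cluster (mutate l T) 1) (cluster (mutate l T) 2) (cluster (mutate l T) 3) = A"
  proof -
    consider "l = 1" | "l = 2" | "l = 3" using l by auto
    then show ?thesis
    proof cases
      case 1
      show ?thesis
        using X.laurent3_mutate X.A_mutate inv(5) unfolding 1 cl(1) by (simp add: X.P_def)
    next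
      case 2
      \<comment> \<open>Mutation at 2 is mutation at the first variable of the rotated cluster; two
        further rotations restore the order 1, 2, 3.\<close>
      interpret Y': laurent3 K "Y.P * inverse ?y" ?z ?x by (rule Y.laurent3_mutate)
      interpret Y'': laurent3 K ?z ?x "Y.P * inverse ?y" by (rule laurent3_rotate) (rule Y'.laurent3_axioms)
      show ?thesis
        using laurent3_rotate[OF Y''.laurent3_axioms] Y''.A_rotate Y'.A_rotate Y.A_mutate X.A_rotate inv(5)
        unfolding 2 cl(2) by (simp add: Y.P_def)
    next
      case 3
      interpret Z': laurent3 K "Z.P * inverse ?z" ?x ?y by (rule Z.laurent3_mutate)
      show ?thesis
        using laurent3_rotate[OF Z'.laurent3_axioms] Z'.A_rotate Z.A_mutate Y.A_rotate X.A_rotate inv(5)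
        unfolding 3 cl(3) by (simp add: Z.P_def)
    qed
  qed
  ultimately show ?thesis by (simp add: markov_invariant_def)
qed

lemma laurent_ring_rank3:
  "nverts T = 3 \<Longrightarrow> laurent_ring K T = rgen (K \<union> {cluster T 1, cluster T 2, cluster T 3} \<union>
     {inverse (cluster T 1), inverse (cluster T 2), inverse (cluster T 3)})"
  by (simp add: laurent_ring_def vertices_def atLeastAtMost_1_3)

section \<open>The upper cluster algebra and the three exchange rings\<close>

locale markov_cluster =
  fixes K :: "'f::field set" and w :: "nat \<Rightarrow> 'f"
  assumes initial: "laurent3 K (w 1) (w 2) (w 3)"
begin

sublocale X: laurent3 K "w 1" "w 2" "w 3" by (rule initial)
sublocale Y: laurent3 K "w 2" "w 3" "w 1" by (rule laurent3_rotate) (rule initial)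
sublocale Z: laurent3 K "w 3" "w 1" "w 2" by (rule laurent3_rotate) (rule Y.laurent3_axioms)

lemma A_eq: "Y.A = X.A" "Z.A = X.A"
  using X.A_rotate Y.A_rotate by simp_all

lemma L_eq: "Y.L = X.L" "Z.L = X.L"
  using X.L_rotate Y.L_rotate by simp_all

text \<open>A power of \<open>w 1 * w 2 * w 3\<close> brings \<open>g\<close> into \<open>A\<close>.
  The powers are then stripped one variable at a time, each in the exchange ring where that variable
  is distinguished; the variables still to be stripped belong to that ring.\<close>

lemma A_iff: "g \<in> X.A \<longleftrightarrow> g \<in> X.exch_ring \<and> g \<in> Y.exch_ring \<and> g \<in> Z.exch_ring"
proof
  assume "g \<in> X.A"
  then show "g \<in> X.exch_ring \<and> g \<in> Y.exch_ring \<and> g \<in> Z.exch_ring"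
    using X.A_exch Y.A_exch Z.A_exch A_eq by auto
next
  assume g: "g \<in> X.exch_ring \<and> g \<in> Y.exch_ring \<and> g \<in> Z.exch_ring"
  then obtain n where "w 1 ^ n * w 2 ^ n * w 3 ^ n * g \<in> X.A"
    using X.clear_denominators[OF X.exch_ring_L] by blast
  then have "w 1 ^ n * (w 2 ^ n * (w 3 ^ n * g)) \<in> X.A" by (simp only: mult.assoc)
  then have "w 2 ^ n * (w 3 ^ n * g) \<in> X.A"
    by (rule X.A_divide_x_power)
      (intro X.exch_ring_mult X.exch_ring_power X.exch_ring_basic(3,4) conjunct1[OF g])
  then have "w 2 ^ n * (w 3 ^ n * g) \<in> Y.A" by (simp only: A_eq)
  then have "w 3 ^ n * g \<in> Y.A"
    by (rule Y.A_divide_x_power)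
      (intro Y.exch_ring_mult Y.exch_ring_power Y.exch_ring_basic(3) conjunct1[OF conjunct2[OF g]])
  then have "w 3 ^ n * g \<in> Z.A" by (simp only: A_eq)
  then have "g \<in> Z.A"
    by (rule Z.A_divide_x_power) (rule conjunct2[OF conjunct2[OF g]])
  then show "g \<in> X.A" by (simp only: A_eq)
qed

lemma markov_invariant_reachable:
  "mutation_equiv (markov_seed w) T \<Longrightarrow> markov_invariant K X.A T"
proof (induction rule: mutation_equiv.induct)
  case refl
  show ?case using initial by (simp add: markov_invariant_def markov_seed_def)
next
  case (step T l)
  then have "l \<in> {1..3}"
    by (simp add: mutable_def vertices_def markov_invariant_def)
  then have "l \<in> {1, 2, 3}" by (simp only: atLeastAtMost_1_3)
  then show ?case using step.IH by (rule markov_invariant_mutate[rotated])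
qed

text \<open>For the inclusion into \<open>A\<close> the initial seed and its three neighbours
  suffice; the other inclusion uses the invariant at every reachable seed.\<close>

lemma upper_cluster_algebra_eq: "upper_cluster_algebra K (markov_seed w) = X.A"
proof
  show "X.A \<subseteq> upper_cluster_algebra K (markov_seed w)"
    unfolding upper_cluster_algebra_def
  proof (rule INF_greatest)
    fix T assume "T \<in> {T. mutation_equiv (markov_seed w) T}"
    then have T: "markov_invariant K X.A T" by (simp add: markov_invariant_reachable)
    then interpret T: laurent3 K "cluster T 1" "cluster T 2" "cluster T 3"
      by (simp add: markov_invariant_def)
    have nv: "nverts T = 3" and "T.A = X.A" using T by (simp_all add: markov_invariant_def)
    then show "X.A \<subseteq> laurent_ring K T"
      using T.A_exch T.exch_ring_L
      unfolding laurent_ring_rank3[OF nv] T.L_eq_rgen[symmetric] by blast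
  qed
  show "upper_cluster_algebra K (markov_seed w) \<subseteq> X.A"
  proof
    fix g assume g: "g \<in> upper_cluster_algebra K (markov_seed w)"
    let ?S = "markov_seed w"
    have S: "nverts ?S = 3" "arrows ?S = markov_arrows \<or> arrows ?S = (\<lambda>i j. markov_arrows j i)"
      "cluster ?S = w"
      by (simp_all add: markov_seed_def)
    have mut: "g \<in> laurent_ring K (mutate l ?S)" if "l \<in> {1, 2, 3}" for l
    proof -
      have "mutation_equiv ?S (mutate l ?S)"
        by (rule mutation_equiv.step[OF mutation_equiv.refl])
          (use that in \<open>auto simp: markov_seed_def mutable_def vertices_def\<close>)
      then show ?thesis using g by (simp add: upper_cluster_algebra_def)
    qed
    have nv: "nverts (mutate l ?S) = 3" for l by (simp add: mutate_def markov_seed_def)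
    note cl = cluster_mutate_markov[OF S(1,2), unfolded S(3)]
    have "g \<in> laurent_ring K ?S"
      using g mutation_equiv.refl[of ?S] unfolding upper_cluster_algebra_def by blast
    then have gL: "g \<in> X.L" by (simp only: X.L_eq_rgen laurent_ring_rank3[OF S(1)] S(3))
    have "g \<in> X.exch_ring"
      by (rule X.mutated_laurent_inter_exch[OF gL])
        (use mut[of 1] in \<open>simp add: laurent_ring_rank3[OF nv] cl(1) X.P_def insert_commute\<close>)
    moreover have "g \<in> Y.exch_ring"
      by (rule Y.mutated_laurent_inter_exch)
        (use mut[of 2] gL in \<open>simp_all add: L_eq laurent_ring_rank3[OF nv] cl(2) Y.P_def insert_commute\<close>)
    moreover have "g \<in> Z.exch_ring"
      by (rule Z.mutated_laurent_inter_exch)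
        (use mut[of 3] gL in \<open>simp_all add: L_eq laurent_ring_rank3[OF nv] cl(3) Z.P_def insert_commute\<close>)
    ultimately show "g \<in> X.A" by (simp add: A_iff)
  qed
qed

section \<open>Maps on \<open>A\<close> that send a given element to 1\<close>

lemma monomial_trace_A:
  assumes "inv_linear q X.L \<Phi>" "X.monomial_trace q \<pi> \<Phi>" "inv_linear q K \<pi>" "q > 0"
  shows "inv_linear q X.A \<Phi>"
proof -
  \<comment> \<open>The same \<open>\<Phi>\<close> is a trace for all three orderings of the
    variables, so it preserves all three exchange rings, whose intersection is
    \<open>A\<close>.\<close>
  have Y: "inv_linear q Y.L \<Phi>" "Y.monomial_trace q \<pi> \<Phi>"
    using assms(1) X.monomial_trace_rotate[OF assms(2)] by (simp_all add: L_eq)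
  have Z: "inv_linear q Z.L \<Phi>" "Z.monomial_trace q \<pi> \<Phi>"
    using assms(1) Y.monomial_trace_rotate[OF Y(2)] by (simp_all add: L_eq)
  have "\<Phi> g \<in> X.A" if "g \<in> X.A" for g
    using that X.monomial_trace_exch[OF assms] Y.monomial_trace_exch[OF Y assms(3,4)]
      Z.monomial_trace_exch[OF Z assms(3,4)] by (simp add: A_iff)
  moreover have "X.A \<subseteq> X.L" using X.A_exch X.exch_ring_L by blast
  ultimately show ?thesis using assms(1) unfolding inv_linear_def by blast
qed

text \<open>
  Iterating \<open>s \<mapsto> \<Phi> (M\<^sup>3 s / 6)\<close>, which maps \<open>xyz\<close> to \<open>1\<close>, reaches \<open>1\<close> from \<open>(xyz)\<^sup>n\<close> with
  \<open>n = 1 + p + \<dots> + p\<^sup>f\<^sup>-\<^sup>1\<close>.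
\<close>

lemma xyz_power_splits:
  assumes "prime CHAR('f)" "CHAR('f) > 2" "(6 :: 'f) \<noteq> 0"
  shows "\<exists>n\<ge>f. \<exists>\<Theta>. inv_linear (CHAR('f) ^ f) X.A \<Theta> \<and> \<Theta> ((w 1 * w 2 * w 3) ^ n) = 1"
proof (induction f)
  case 0
  have "inv_linear (CHAR('f) ^ 0) X.A id" by (simp add: inv_linear_def)
  then show ?case
    by (intro exI[of _ 0] conjI exI[of _ id]) (assumption | simp)+
next
  case (Suc f)
  let ?p = "CHAR('f)" and ?c = "w 1 * w 2 * w 3"
  obtain n \<Theta> where n: "n \<ge> f" "inv_linear (?p ^ f) X.A \<Theta>" "\<Theta> (?c ^ n) = 1" using Suc by blast
  have p1: "?p = ?p ^ 1" and p0: "?p > 0" using assms(2) by simp_all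
  have K1: "1 \<in> K" by (rule X.K_closed)
  obtain \<pi> where \<pi>: "inv_linear ?p K \<pi>" "\<pi> 1 = 1"
    using inv_linear_functional[OF X.subfield_K assms(1) p1 K1] by auto
  obtain \<Phi> where \<Phi>: "inv_linear ?p X.L \<Phi>" "X.monomial_trace ?p \<pi> \<Phi>"
    using X.monomial_trace_exists[OF assms(1) p1 \<pi>(1)] by blast
  define \<theta> where "\<theta> s = \<Phi> (X.M ^ 3 * inverse 6 * s)" for s
  have "X.M ^ 3 * inverse 6 \<in> X.A"
    using X.K_closed(7)[OF X.numeral_K] by (intro X.A_mult X.A_power X.A_gens)
  then have \<theta>: "inv_linear ?p X.A \<theta>"
    unfolding \<theta>_def by (rule inv_linear_premult[OF monomial_trace_A[OF \<Phi> \<pi>(1) p0]]) (rule X.A_mult)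
  have c: "?c \<in> X.A" by (intro X.A_mult X.A_gens)
  have "\<theta> ?c = 1"
    unfolding \<theta>_def by (rule X.monomial_trace_xyz_M_cubed[OF \<Phi> \<pi> assms(2,3)])
  then have "\<theta> ((?c ^ n) ^ ?p * ?c) = ?c ^ n"
    using inv_linearD(3)[OF \<theta> X.A_power[OF c] c] by simp
  moreover have "?c ^ (n * ?p + 1) = (?c ^ n) ^ ?p * ?c"
    by (simp only: power_add power_mult power_one_right)
  ultimately have "(\<Theta> \<circ> \<theta>) (?c ^ (n * ?p + 1)) = 1" using n(3) by (simp only: comp_apply)
  moreover have "inv_linear (?p ^ Suc f) X.A (\<Theta> \<circ> \<theta>)"
    using inv_linear_compose[OF \<theta> n(2) X.A_power] by simp
  moreover have "n \<le> n * ?p" using p0 by simp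
  \<comment> \<open>The bound \<open>n \<ge> f\<close> is what later allows \<open>n\<close> to be
    taken beyond any given number.\<close>
  then have "n * ?p + 1 \<ge> Suc f" using n(1) by linarith
  ultimately show ?case by blast
qed

text \<open>The isolating map uses the factor \<open>X.mon m\<close>, which can lie outside
  \<open>A\<close>. Multiplying it by \<open>(?c ^ n) ^ q\<close> with \<open>n\<close> large brings
  it into \<open>A\<close>, at the cost of the value \<open>?c ^ n\<close> in place of 1, which
  \<open>\<Theta>\<close> then sends to 1.\<close>

lemma A_splits:
  assumes "prime CHAR('f)" "CHAR('f) > 2" "(6 :: 'f) \<noteq> 0" and g: "g \<in> X.A" "g \<noteq> 0"
  shows "\<exists>e \<Psi>. inv_linear (CHAR('f) ^ e) X.A \<Psi> \<and> \<Psi> g = 1"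
proof -
  let ?c = "w 1 * w 2 * w 3"
  have gL: "g \<in> X.L" using X.exch_ring_L[OF X.A_exch[OF g(1)]] .
  obtain e \<pi> \<Phi> m where \<Phi>: "inv_linear (CHAR('f) ^ e) X.L \<Phi>" "X.monomial_trace (CHAR('f) ^ e) \<pi> \<Phi>"
      "inv_linear (CHAR('f) ^ e) K \<pi>" and one: "\<Phi> (X.mon m * g) = 1"
    using X.monomial_trace_isolate[OF assms(1) gL g(2)] by blast
  define q where "q = CHAR('f) ^ e"
  have q: "q > 0" using assms(2) by (simp add: q_def)
  have mL: "X.mon m \<in> X.L" by (rule X.mon_in_Lspan) simp
  obtain N where N: "\<And>n. n \<ge> N \<Longrightarrow> w 1 ^ n * w 2 ^ n * w 3 ^ n * X.mon m \<in> X.A"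
    using X.clear_denominators[OF mL] by blast
  obtain n \<Theta> where n: "n \<ge> N" "inv_linear (CHAR('f) ^ N) X.A \<Theta>" "\<Theta> (?c ^ n) = 1"
    using xyz_power_splits[OF assms(1-3)] by blast
  have c: "?c \<in> X.A" by (intro X.A_mult X.A_gens)
  define v where "v = (?c ^ n) ^ q * X.mon m"
  have "n \<le> n * q" using q by simp
  then have "n * q \<ge> N" using n(1) by linarith
  from N[OF this] have "v \<in> X.A"
    by (simp only: v_def power_mult power_mult_distrib)
  then have "inv_linear q X.A (\<lambda>s. \<Phi> (v * s))"
    by (rule inv_linear_premult[OF monomial_trace_A[OF \<Phi>[folded q_def] q]]) (rule X.A_mult)
  from inv_linear_compose[OF this n(2) X.A_power]
  have "inv_linear (CHAR('f) ^ (e + N)) X.A (\<Theta> \<circ> (\<lambda>s. \<Phi> (v * s)))"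
    by (simp only: q_def power_add)
  moreover have "\<Phi> (v * g) = ?c ^ n * \<Phi> (X.mon m * g)"
    using inv_linearD(3)[OF \<Phi>(1) X.exch_ring_L[OF X.A_exch[OF X.A_power[OF c]]] X.L_mult[OF mL gL], of n]
    by (simp only: v_def q_def mult.assoc)
  then have "(\<Theta> \<circ> (\<lambda>s. \<Phi> (v * s))) g = 1" using one n(3) by simp
  ultimately show ?thesis by blast
qed

end

theorem proposition5p3:
  fixes K :: "'f::field set" and x :: "nat \<Rightarrow> 'f" and p :: nat
  assumes "subfield K ring_of_type_algebra"
    and "CHAR('f) = p" and "p > 0" and "p \<noteq> 2" and "p \<noteq> 3"
    and "F_finite K"
    and "is_seed K (markov_seed x)"
  shows "strongly_F_regular (upper_cluster_algebra K (markov_seed x))"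
proof -
  have "alg_independent K {1..3} x"
    using assms(7) by (simp add: is_seed_def markov_seed_def vertices_def)
  then interpret markov_cluster K x
    by (intro markov_cluster.intro laurent3_of_alg_independent[OF assms(1)])
  have prime: "prime CHAR('f)" using assms(2,3) by (intro prime_CHAR_semidom) simp
  \<comment> \<open>A prime other than 2 exceeds 2, so that -2 is no multiple of it, as the trace of
    \<open>x y z M^3\<close> requires.\<close>
  then have p2: "CHAR('f) > 2" using assms(2,4) prime_ge_2_nat[of p] by simp
  have six: "(6 :: 'f) \<noteq> 0"
  proof
    assume "(6 :: 'f) = 0"
    then have "of_nat (2 * 3) = (0 :: 'f)" by simp
    then have "p dvd 2 * 3" using assms(2) by (simp only: of_nat_eq_0_iff_char_dvd)
    then have "p dvd 2 \<or> p dvd 3" using prime assms(2) prime_dvd_mult_iff by blast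
    then have "p \<le> 3" using dvd_imp_le[of p 2] dvd_imp_le[of p 3] by auto
    then show False using p2 assms(2,5) by simp
  qed
  show ?thesis
    unfolding upper_cluster_algebra_eq
  proof (rule strongly_F_regularI[OF prime])
    show "subdomain X.A ring_of_type_algebra"
      unfolding X.A_def by (rule subdomain_rgen)
    show "F_finite X.A"
      unfolding X.A_def by (rule F_finite_rgen[OF prime assms(1,6)]) simp
    show "\<exists>e \<Phi>. inv_linear (CHAR('f) ^ e) X.A \<Phi> \<and> \<Phi> a = 1" if "a \<in> X.A" "a \<noteq> 0" for a
      by (rule A_splits[OF prime p2 six that])
  qed (rule X.A_add X.A_mult X.A_power, assumption+)+
qed

end
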